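(* Let $>$ be a term order on $[X]$ and let $I\subset R'$ be an $r$-homogeneous locally finitely generated ideal. For each $n\ge 1$ define $g_n\in\mathbb{Z}[t_1,\dots,t_r]$ by requiring that $$\frac{g_n}{\prod_{i=1}^n (1-t_{y(i)})}$$ is the $\mathbb{N}^r$-graded Hilbert series of $K[x_1,\dots,x_n]/\rho_n(I)$. Then $\kappa(p(\mathrm{in}_>(I)))\in\mathbb{Z}[[t_1,\dots,t_r]]$ and $g_n\to\kappa(p(\mathrm{in}_>(I)))$ as $n\to\infty$ in the $(t_1,\dots,t_r)$-adic topology.
   Context: $K$ is a field containing $\mathbb{Q}$; $X=\{x_1,x_2,\dots\}$; $[X]$ is the free abelian monoid of monomials in $X$, and $|m|$ is the total degree of a monomial $m$. $K[[X]]$ is the ring of all formal sums $\sum_{m\in[X]}c_m m$ with $c_m\in K$, with convolution product; $\mathbb{Z}[[X]]$ is the analogous ring over $\mathbb{Z}$. $R'\subset K[[X]]$ is the subring of elements whose supports have bounded total degree. The truncation $\rho_n:R'\to K[x_1,\dots,x_n]$ deletes all monomials involving some $x_i$ with $i>n$. Grading: fix a positive integer $r$ and a partition $X=\bigcup_{\ell=1}^r Y_\ell$, and let $y:\mathbb{N}^+\to\{1,\dots,r\}$ satisfy $x_n\in Y_{y(n)}$. Setting $\deg x_i=e_{y(i)}$ (the standard basis vector) makes $R'$ and $K[x_1,\dots,x_n]$ $\mathbb{N}^r$-graded; an ideal is $r$-homogeneous if it is homogeneous for this grading. A (total-degree) homogeneous ideal of $R'$ is locally finitely generated if it is generated by a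 set of homogeneous elements containing only finitely many elements of each total degree. A term order on $[X]$ is a multiplicative total order whose restriction to $\{x_1,x_2,\dots\}$ is order-isomorphic to $-\omega$ (the reverse of the natural numbers). For nonzero homogeneous $f\in R'$, $\mathrm{in}_>(f)$ is the $>$-largest monomial in the support of $f$ (it exists). For a homogeneous ideal $I$, $\mathrm{in}_>(I)$ is the ideal of $R'$ generated by all $\mathrm{in}_>(f)$, $0\ne f\in I$ homogeneous. For a monomial ideal $J$, $p(J)=\mu\cdot\sum_{m\in[X]\setminus J}m\in\mathbb{Z}[[X]]$, where $\mu=\prod_{i\ge1}(1-x_i)$. $\mathcal{S}\subset\mathbb{Z}[[X]]$ is the subring of those $f$ having only finitely many monomials of each total degree in their support, and $\kappa:\mathcal{S}\to\mathbb{Z}[[t_1,\dots,t_r]]$ is the substitution $x_i\mapsto t_{y(i)}$. *)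

theory Defs
  imports
    Complex_Main
    "HOL-Library.Poly_Mapping"
    "HOL-Algebra.Algebra"
begin

section \<open>Formal power series in an arbitrary family of variables\<close>

text \<open>
  Monomials over the index set \<^typ>\<open>'v\<close> are exponent functions of finite support, written
  additively: \<open>m + m'\<close> is the product of monomials and \<open>0\<close> is the monomial \<open>1\<close>.
  An element of \<open>('v, 'a) mps\<close> is an arbitrary formal sum of monomials, so that
  \<open>(nat, 'k) mps\<close> is \<open>K[[X]]\<close>, with index \<open>i\<close> standing for the variable \<open>x\<^sub>i\<^sub>+\<^sub>1\<close>,
  and \<open>('r, int) mps\<close> is \<open>\<int>[[t\<^sub>1,\<dots>,t\<^sub>r]]\<close> for a finite type \<^typ>\<open>'r\<close> with \<open>r\<close> elements.
\<close>

type_synonym 'v mon = "'v \<Rightarrow>\<^sub>0 nat"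

typedef ('v, 'a) mps = "UNIV :: ('v mon \<Rightarrow> 'a) set"
  morphisms coef MPS
  by simp

lemma coef_MPS [simp]: "coef (MPS c) = c"
  by (simp add: MPS_inverse)

lemma MPS_coef [simp]: "MPS (coef f) = f"
  by (rule coef_inverse)

lemma mps_eqI: "(\<And>m. coef f m = coef g m) \<Longrightarrow> f = g"
  by (simp add: coef_inject[symmetric] ext)

definition antidiag :: "'v mon \<Rightarrow> ('v mon \<times> 'v mon) set" where
  "antidiag m = {(a, b). a + b = m}"

lemma finite_antidiag [simp]: "finite (antidiag m)"
proof -
  let ?L = "\<lambda>a. restrict (Poly_Mapping.lookup a) (Poly_Mapping.keys m)"
  let ?A = "fst ` antidiag m"
  have sub: "Poly_Mapping.keys a \<subseteq> Poly_Mapping.keys m" if "a \<in> ?A" for a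
    using that unfolding antidiag_def by (auto simp: Poly_Mapping.in_keys_iff Poly_Mapping.lookup_add)
  have "?L ` ?A \<subseteq> (\<Pi>\<^sub>E i\<in>Poly_Mapping.keys m. {..Poly_Mapping.lookup m i})"
    by (auto simp: antidiag_def lookup_add)
  moreover have "finite (\<Pi>\<^sub>E i\<in>Poly_Mapping.keys m. {..Poly_Mapping.lookup m i})"
    by (intro finite_PiE) auto
  moreover have "inj_on ?L ?A"
  proof (rule inj_onI)
    fix a b assume a: "a \<in> ?A" and b: "b \<in> ?A" and eq: "?L a = ?L b"
    show "a = b"
    proof (rule poly_mapping_eqI)
      fix k
      show "Poly_Mapping.lookup a k = Poly_Mapping.lookup b k"
      proof (cases "k \<in> Poly_Mapping.keys m")
        case True
        then show ?thesis using fun_cong[OF eq, of k] by simp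
      next
        case False
        then have "k \<notin> Poly_Mapping.keys a" "k \<notin> Poly_Mapping.keys b"
          using sub[OF a] sub[OF b] by blast+
        then show ?thesis by (simp add: Poly_Mapping.in_keys_iff)
      qed
    qed
  qed
  ultimately have "finite ?A"
    using finite_imageD[OF finite_subset] by simp
  moreover have "antidiag m \<subseteq> (\<lambda>a. (a, m - a)) ` ?A"
  proof
    fix p assume p: "p \<in> antidiag m"
    then have "p = (fst p, m - fst p)"
      by (auto simp: antidiag_def)
    with p show "p \<in> (\<lambda>a. (a, m - a)) ` ?A"
      by blast
  qed
  ultimately show ?thesis
    by (rule finite_surj)
qed

instantiation mps :: (type, comm_ring_1) comm_ring_1
begin

definition "0 = MPS (\<lambda>m. 0)"
definition "1 = MPS (\<lambda>m. 1 when m = 0)"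
definition "f + g = MPS (\<lambda>m. coef f m + coef g m)"
definition "f - g = MPS (\<lambda>m. coef f m - coef g m)"
definition "- f = MPS (\<lambda>m. - coef f m)"
definition "f * g = MPS (\<lambda>m. \<Sum>(a, b)\<in>antidiag m. coef f a * coef g b)"

instance
proof
  fix f g h :: "('a, 'b) mps"
  show "f * g * h = f * (g * h)"
  proof (rule mps_eqI)
    fix m :: "'a mon"
    have "coef (f * g * h) m =
        (\<Sum>(p, c)\<in>antidiag m. \<Sum>(a, b)\<in>antidiag p. coef f a * coef g b * coef h c)"
      by (simp add: times_mps_def sum_distrib_right case_prod_unfold)
    also have "\<dots> = (\<Sum>(q, ab)\<in>Sigma (antidiag m) (\<lambda>q. antidiag (fst q)).
        coef f (fst ab) * coef g (snd ab) * coef h (snd q))"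
      by (subst sum.Sigma[symmetric]) (auto simp: case_prod_unfold)
    also have "\<dots> = (\<Sum>(q, bc)\<in>Sigma (antidiag m) (\<lambda>q. antidiag (snd q)).
        coef f (fst q) * (coef g (fst bc) * coef h (snd bc)))"
      by (rule sum.reindex_bij_witness[where
            i = "\<lambda>((a, r), (b, c)). ((a + b, c), (a, b))" and
            j = "\<lambda>((p, c), (a, b)). ((a, b + c), (b, c))"])
         (auto simp: antidiag_def add.assoc mult.assoc)
    also have "\<dots> = (\<Sum>(a, r)\<in>antidiag m. \<Sum>(b, c)\<in>antidiag r. coef f a * (coef g b * coef h c))"
      by (subst sum.Sigma[symmetric]) (auto simp: case_prod_unfold)
    also have "\<dots> = coef (f * (g * h)) m"
      by (simp add: times_mps_def sum_distrib_left case_prod_unfold)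
    finally show "coef (f * g * h) m = coef (f * (g * h)) m" .
  qed
  show "f * g = g * f"
    unfolding times_mps_def
    by (intro arg_cong[where f = MPS] ext sum.reindex_bij_witness[where i = prod.swap and j = prod.swap])
       (auto simp: antidiag_def add.commute mult.commute)
  show "1 * f = f"
  proof (rule mps_eqI)
    fix m :: "'a mon"
    have "coef (1 * f) m = (\<Sum>x\<in>antidiag m. if x = (0, m) then coef f m else 0)"
      unfolding times_mps_def one_mps_def coef_MPS
      by (intro sum.cong) (auto simp: antidiag_def when_def split: if_splits)
    also have "\<dots> = coef f m"
      by (subst sum.delta) (simp_all, simp add: antidiag_def)
    finally show "coef (1 * f) m = coef f m" .
  qed
  show "(f + g) * h = f * h + g * h"
    by (simp add: times_mps_def plus_mps_def case_prod_unfold distrib_right sum.distrib)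
  have "coef (0 :: ('a, 'b) mps) 0 \<noteq> coef 1 0"
    by (simp add: zero_mps_def one_mps_def)
  then show "(0 :: ('a, 'b) mps) \<noteq> 1" by metis
qed (simp_all add: zero_mps_def plus_mps_def minus_mps_def uminus_mps_def ac_simps)

end

definition supp :: "('v, 'a::zero) mps \<Rightarrow> 'v mon set" where
  "supp f = {m. coef f m \<noteq> 0}"

definition monomial :: "'v mon \<Rightarrow> 'a::zero \<Rightarrow> ('v, 'a) mps" where
  "monomial m c = MPS (\<lambda>m'. c when m' = m)"

definition var_mon :: "'v \<Rightarrow> 'v mon" where
  "var_mon i = Poly_Mapping.single i 1"


section \<open>Degrees and gradings\<close>

definition tdeg :: "'v mon \<Rightarrow> nat" where
  "tdeg m = (\<Sum>i\<in>Poly_Mapping.keys m. Poly_Mapping.lookup m i)"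

text \<open>
  The \<open>\<nat>\<^sup>r\<close>-degree with \<open>deg x\<^sub>i = e\<^bsub>y(i)\<^esub>\<close>. Its values are themselves exponent vectors
  of monomials in \<open>t\<^sub>1,\<dots>,t\<^sub>r\<close>.
\<close>

definition mdeg :: "('v \<Rightarrow> 'r) \<Rightarrow> 'v mon \<Rightarrow> 'r mon" where
  "mdeg y m = (\<Sum>i\<in>Poly_Mapping.keys m. Poly_Mapping.single (y i) (Poly_Mapping.lookup m i))"

text \<open>Below, \<open>\<delta>\<close> is a grading of the monomials: \<^const>\<open>tdeg\<close> or \<open>mdeg y\<close>.\<close>

definition homogeneous :: "('v mon \<Rightarrow> 'd) \<Rightarrow> 'd \<Rightarrow> ('v, 'a::zero) mps \<Rightarrow> bool" where
  "homogeneous \<delta> d f \<longleftrightarrow> (\<forall>m\<in>supp f. \<delta> m = d)"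

definition component :: "('v mon \<Rightarrow> 'd) \<Rightarrow> 'd \<Rightarrow> ('v, 'a::zero) mps \<Rightarrow> ('v, 'a) mps" where
  "component \<delta> d f = MPS (\<lambda>m. coef f m when \<delta> m = d)"

definition homogeneous_ideal :: "('v mon \<Rightarrow> 'd) \<Rightarrow> ('v, 'a::zero) mps set \<Rightarrow> bool" where
  "homogeneous_ideal \<delta> I \<longleftrightarrow> (\<forall>f\<in>I. \<forall>d. component \<delta> d f \<in> I)"


section \<open>The rings\<close>

definition mps_ring :: "('v, 'a::comm_ring_1) mps set \<Rightarrow> ('v, 'a) mps ring" where
  "mps_ring A = \<lparr>carrier = A, monoid.mult = (*), one = 1, ring.zero = 0, add = (+)\<rparr>"

text \<open>The ring \<open>R'\<close>.\<close>

definition bounded_ring :: "('v, 'a::comm_ring_1) mps ring" where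
  "bounded_ring = mps_ring {f. \<exists>d. \<forall>m\<in>supp f. tdeg m \<le> d}"

definition polys :: "'v set \<Rightarrow> ('v, 'a::zero) mps set" where
  "polys V = {f. finite (supp f) \<and> (\<forall>m\<in>supp f. Poly_Mapping.keys m \<subseteq> V)}"

abbreviation polynomial_ring :: "'v set \<Rightarrow> ('v, 'a::comm_ring_1) mps ring" where
  "polynomial_ring V \<equiv> mps_ring (polys V)"

lemma tdeg_add: "tdeg (a + b) = tdeg a + tdeg b"
  unfolding tdeg_def by (rule setsum_keys_plus_distrib) auto

lemma supp_add: "supp (f + g) \<subseteq> supp f \<union> supp (g :: ('v, 'a::comm_ring_1) mps)"
  by (auto simp: supp_def plus_mps_def)

lemma supp_uminus: "supp (- f) = supp (f :: ('v, 'a::comm_ring_1) mps)"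
  by (auto simp: supp_def uminus_mps_def)

lemma supp_mult:
  "supp (f * g) \<subseteq> (\<lambda>(a, b). a + b) ` (supp f \<times> supp (g :: ('v, 'a::comm_ring_1) mps))"
proof
  fix m assume "m \<in> supp (f * g)"
  then have "(\<Sum>(a, b)\<in>antidiag m. coef f a * coef g b) \<noteq> 0"
    by (simp add: supp_def times_mps_def)
  then obtain q where "q \<in> antidiag m" "(case q of (a, b) \<Rightarrow> coef f a * coef g b) \<noteq> 0"
    by (rule sum.not_neutral_contains_not_neutral)
  then obtain a b where "a + b = m" "coef f a * coef g b \<noteq> 0"
    by (auto simp: antidiag_def)
  then show "m \<in> (\<lambda>(a, b). a + b) ` (supp f \<times> supp g)"
    by (auto simp: supp_def intro!: image_eqI[of _ _ "(a, b)"])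
qed

lemma cring_mps_ring:
  fixes A :: "('v, 'a::comm_ring_1) mps set"
  assumes "0 \<in> A" "1 \<in> A" "\<And>f g. f \<in> A \<Longrightarrow> g \<in> A \<Longrightarrow> f + g \<in> A"
    "\<And>f. f \<in> A \<Longrightarrow> - f \<in> A" "\<And>f g. f \<in> A \<Longrightarrow> g \<in> A \<Longrightarrow> f * g \<in> A"
  shows "cring (mps_ring A)"
proof (rule cringI)
  show "abelian_group (mps_ring A)"
    by (rule abelian_groupI)
       (use assms in \<open>auto simp: mps_ring_def algebra_simps intro!: bexI[of _ "- _"]\<close>)
  show "comm_monoid (mps_ring A)"
    by (rule comm_monoidI) (use assms in \<open>auto simp: mps_ring_def algebra_simps\<close>)
qed (auto simp: mps_ring_def algebra_simps)

lemma supp_0_1: "supp (0 :: ('v, 'a::comm_ring_1) mps) = {}" "supp (1 :: ('v, 'a) mps) = {0}"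
  by (auto simp: supp_def zero_mps_def one_mps_def when_def)

lemma cring_bounded_ring: "cring (bounded_ring :: ('v, 'a::comm_ring_1) mps ring)"
  unfolding bounded_ring_def
proof (rule cring_mps_ring; clarsimp simp: supp_0_1 supp_uminus)
  fix f g :: "('v, 'a) mps" and d e
  assume f: "\<forall>m\<in>supp f. tdeg m \<le> d" and g: "\<forall>m\<in>supp g. tdeg m \<le> e"
  show "\<exists>d. \<forall>m\<in>supp (f + g). tdeg m \<le> d"
    by (rule exI[of _ "d + e"]) (use f g supp_add[of f g] in force)
  have "tdeg m \<le> d + e" if "m \<in> supp (f * g)" for m
    using subsetD[OF supp_mult that] f g by (auto simp: tdeg_add add_mono)
  then show "\<exists>d. \<forall>m\<in>supp (f * g). tdeg m \<le> d" by blast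
qed auto

lemma cring_polynomial_ring: "cring (polynomial_ring V :: ('v, 'a::comm_ring_1) mps ring)"
proof (rule cring_mps_ring; clarsimp simp: polys_def supp_0_1 supp_uminus)
  fix f g :: "('v, 'a) mps"
  assume fin: "finite (supp f)" "finite (supp g)"
    and sub: "\<forall>m\<in>supp f. Poly_Mapping.keys m \<subseteq> V" "\<forall>m\<in>supp g. Poly_Mapping.keys m \<subseteq> V"
  show "finite (supp (f + g)) \<and> (\<forall>m\<in>supp (f + g). Poly_Mapping.keys m \<subseteq> V)"
    using fin sub finite_subset[OF supp_add[of f g]] supp_add[of f g] by blast
  have "finite (supp (f * g))"
    by (rule finite_subset[OF supp_mult]) (use fin in auto)
  moreover have "Poly_Mapping.keys m \<subseteq> V" if m: "m \<in> supp (f * g)" for m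
  proof -
    obtain a b where "m = a + b" "a \<in> supp f" "b \<in> supp g"
      using subsetD[OF supp_mult m] by auto
    then show ?thesis using sub Poly_Mapping.keys_add[of a b] by blast
  qed
  ultimately show "finite (supp (f * g)) \<and> (\<forall>m\<in>supp (f * g). Poly_Mapping.keys m \<subseteq> V)" by blast
qed

definition trunc :: "nat \<Rightarrow> (nat, 'a::zero) mps \<Rightarrow> (nat, 'a) mps" where
  "trunc n f = MPS (\<lambda>m. coef f m when Poly_Mapping.keys m \<subseteq> {..<n})"

definition locally_fin_gen :: "('v, 'a::comm_ring_1) mps set \<Rightarrow> bool" where
  "locally_fin_gen I \<longleftrightarrow> homogeneous_ideal tdeg I \<and>
     (\<exists>S \<subseteq> carrier bounded_ring. I = Idl\<^bsub>bounded_ring\<^esub> S \<and> (\<forall>f\<in>S. \<exists>d. homogeneous tdeg d f) \<and>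
        (\<forall>d. finite {f\<in>S. homogeneous tdeg d f}))"


section \<open>Term orders and initial ideals\<close>

text \<open>
  \<open>gt m m'\<close> stands for \<open>m > m'\<close>. The bijection \<open>\<sigma>\<close> lists the variables in strictly decreasing
  order; it need not be the identity, since only the order type \<open>-\<omega>\<close> is prescribed.
\<close>

definition term_order :: "(nat mon \<Rightarrow> nat mon \<Rightarrow> bool) \<Rightarrow> bool" where
  "term_order gt \<longleftrightarrow> irreflp gt \<and> transp gt \<and> totalp gt \<and>
     (\<forall>a b c. gt a b \<longrightarrow> gt (a + c) (b + c)) \<and>
     (\<exists>\<sigma> :: nat \<Rightarrow> nat. bij \<sigma> \<and> (\<forall>i j. gt (var_mon (\<sigma> i)) (var_mon (\<sigma> j)) \<longleftrightarrow> i < j))"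

definition initial :: "('v mon \<Rightarrow> 'v mon \<Rightarrow> bool) \<Rightarrow> ('v, 'a::zero) mps \<Rightarrow> 'v mon" where
  "initial gt f = (THE m. m \<in> supp f \<and> (\<forall>m'\<in>supp f. m' \<noteq> m \<longrightarrow> gt m m'))"

definition initial_ideal ::
    "('v mon \<Rightarrow> 'v mon \<Rightarrow> bool) \<Rightarrow> ('v, 'a::comm_ring_1) mps set \<Rightarrow> ('v, 'a) mps set" where
  "initial_ideal gt I = Idl\<^bsub>bounded_ring\<^esub>
     {monomial (initial gt f) 1 | f. f \<in> I \<and> f \<noteq> 0 \<and> (\<exists>d. homogeneous tdeg d f)}"


section \<open>Hilbert series\<close>

text \<open>
  The \<open>\<nat>\<^sup>r\<close>-graded Hilbert series of \<open>K[V] / J\<close>. The graded component of the quotient in degree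
  \<open>\<alpha>\<close> is the set of residue classes of the homogeneous polynomials of degree \<open>\<alpha>\<close>; its dimension is
  taken over the image of \<open>K\<close> in the quotient ring. All dimensions are finite for finite \<open>V\<close>.
\<close>

definition hilbert_series ::
    "('v \<Rightarrow> 'r) \<Rightarrow> 'v set \<Rightarrow> ('v, 'k::field) mps set \<Rightarrow> ('r, int) mps" where
  "hilbert_series y V J =
     (let A = polynomial_ring V;
          cls = (\<lambda>f. J +>\<^bsub>A\<^esub> f)
      in MPS (\<lambda>\<alpha>. int (ring.dim (A Quot J) (cls ` range (monomial 0))
                         (cls ` {f \<in> carrier A. homogeneous (mdeg y) \<alpha> f}))))"


section \<open>The series \<open>p(J)\<close> and the substitution \<open>\<kappa>\<close>\<close>

text \<open>The infinite product \<open>\<mu>\<close>, as the coefficientwise limit of its finite partial products.\<close>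

definition mu :: "(nat, int) mps" where
  "mu = MPS (\<lambda>m. lim (\<lambda>n. coef (\<Prod>i<n. 1 - monomial (var_mon i) 1 :: (nat, int) mps) m))"

definition p_series :: "(nat, 'a::zero_neq_one) mps set \<Rightarrow> (nat, int) mps" where
  "p_series J = mu * MPS (\<lambda>m. 1 when monomial m 1 \<notin> J)"

text \<open>The ring \<open>\<S>\<close>, the domain of \<open>\<kappa>\<close>; \<open>kappa y f\<close> is meaningful only for \<open>f\<close> in it.\<close>

definition loc_finite :: "('v, 'a::zero) mps set" where
  "loc_finite = {f. \<forall>d. finite {m \<in> supp f. tdeg m = d}}"

definition kappa :: "('v \<Rightarrow> 'r) \<Rightarrow> ('v, 'a::comm_monoid_add) mps \<Rightarrow> ('r, 'a) mps" where
  "kappa y f = MPS (\<lambda>\<alpha>. \<Sum>m | m \<in> supp f \<and> mdeg y m = \<alpha>. coef f m)"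


section \<open>Adic convergence\<close>

primrec ideal_power :: "('a, 'b) ring_scheme \<Rightarrow> 'a set \<Rightarrow> nat \<Rightarrow> 'a set" where
  "ideal_power R I 0 = carrier R"
| "ideal_power R I (Suc d) = ideal_prod R (ideal_power R I d) I"

text \<open>Convergence in \<open>\<int>[[t\<^sub>1,\<dots>,t\<^sub>r]]\<close> for the adic topology of the ideal \<open>(t\<^sub>1,\<dots>,t\<^sub>r)\<close>.\<close>

definition adic_tendsto :: "(nat \<Rightarrow> ('r::finite, int) mps) \<Rightarrow> ('r, int) mps \<Rightarrow> bool" where
  "adic_tendsto g L \<longleftrightarrow>
     (\<forall>d. \<forall>\<^sub>F n in sequentially.
        g n - L \<in> ideal_power (mps_ring UNIV) (Idl\<^bsub>mps_ring UNIV\<^esub> range (\<lambda>i. monomial (var_mon i) 1)) d)"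

end

theory Submission
  imports Defs
begin

text \<open>
  Let \<open>M\<close> be the set of leading monomials of homogeneous elements of \<open>I\<close>; these are the monomials of
  the initial ideal. Everything rests on one finiteness property of \<open>M\<close> (\<open>ex_stable_upto\<close>): for each
  degree \<open>d\<close> there is an \<open>N\<close> such that a monomial of \<open>M\<close> of degree at most \<open>d\<close> stays in \<open>M\<close> when all
  variables of index at least \<open>N\<close> are deleted from it. Up to degree \<open>d\<close>, whether a monomial lies in
  \<open>M\<close> then depends only on its part in the first \<open>N\<close> variables.

  Consequently, if \<open>n \<ge> N\<close>, the sum of the monomials outside \<open>M\<close> agrees up to degree \<open>d\<close> with
  the sum of those in the first \<open>n\<close> variables, divided by \<open>\<Prod>(1 - x\<^sub>i)\<close> over the
  remaining variables. Multiplication by \<open>\<mu>\<close> cancels this denominator, so that \<open>p\<close> involves only the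
  first \<open>N\<close> variables up to degree \<open>d\<close>, and \<open>\<kappa>(p)\<close> agrees up to degree \<open>d\<close> with
  \<open>\<Prod>(1 - t\<^bsub>y(i)\<^esub>)\<close>, the product over \<open>i < n\<close>, times the series counting the monomials
  outside \<open>M\<close> in the first \<open>n\<close> variables by their multidegree. By Macaulay's theorem
  (\<open>coef_hilbert_series\<close>) the Hilbert series in the definition of \<open>g\<^sub>n\<close> counts the monomials that are
  not leading monomials of \<open>\<rho>\<^sub>n(I)\<close>. It remains to see that for \<open>n \<ge> N\<close> truncation creates no new
  leading monomials up to degree \<open>d\<close> (\<open>leads_trunc\<close>). For this, \<open>f \<in> I\<close> is divided by elements
  \<open>\<gamma>\<^sub>b\<close> of \<open>I\<close> with leading monomials \<open>b\<close> in the first \<open>n\<close> variables, giving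
  \<open>f = \<Sum> h\<^sub>b \<gamma>\<^sub>b\<close> with quotients \<open>h\<^sub>b\<close> that involve only the other variables. The products
  then have distinct leading monomials, truncation preserves this shape, and so the leading monomial
  of the truncation is a multiple of some \<open>b\<close>.

  The finiteness property is proved by induction on \<open>d\<close>, without S-polynomials. Let \<open>T\<close> be the space
  of all \<open>\<Sum> h\<^sub>b \<gamma>\<^sub>b\<close> of degree \<open>d + 1\<close>, where \<open>b\<close> runs over the monomials of \<open>M\<close> of degree at
  most \<open>d\<close> in the first \<open>N\<close> variables and \<open>h\<^sub>b\<close> involves only the other variables. An element of
  \<open>I\<close> of degree \<open>d + 1\<close> is a finite sum of products \<open>r s\<close> with generators \<open>s\<close>. The part of \<open>r\<close> in the
  first \<open>N\<close> variables contributes elements of a fixed space of finite dimension, since only finitely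
  many generators have degree at most \<open>d + 1\<close>. The rest of \<open>r\<close> is an infinite sum of multiples
  \<open>x\<^sub>j r\<^sub>j\<close> with \<open>j \<ge> N\<close>; by induction \<open>r\<^sub>j s = \<Sum> h\<^bsub>j,b\<^esub> \<gamma>\<^sub>b\<close>, and multiplying by \<open>x\<^sub>j\<close> and summing
  over \<open>j\<close> leads into \<open>T\<close>. Hence \<open>I\<close> in degree \<open>d + 1\<close> is contained in \<open>T\<close> plus a space of finite
  dimension. Each extra dimension adds at most one leading monomial, so enlarging \<open>N\<close> by the variables
  of finitely many monomials completes the induction step (\<open>stable_upto_Suc\<close>).

  That \<open>g\<^sub>n\<close> is a polynomial is Dickson's lemma: the leading monomials of \<open>\<rho>\<^sub>n(I)\<close> have finitely many
  generators, and multiplying the sum of the other monomials by \<open>1 - x\<^sub>i\<close> kills all coefficients at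
  monomials in which the exponent of \<open>x\<^sub>i\<close> exceeds those in the generators (\<open>numerator_finite\<close>).
\<close>

section \<open>Monomials\<close>

abbreviation vars :: "'v mon \<Rightarrow> 'v set" where "vars \<equiv> Poly_Mapping.keys"
abbreviation expo :: "'v mon \<Rightarrow> 'v \<Rightarrow> nat" where "expo \<equiv> Poly_Mapping.lookup"

lemma in_vars_iff: "i \<in> vars m \<longleftrightarrow> 0 < expo m i"
  by (simp add: Poly_Mapping.in_keys_iff)

lemma mon_eqI: "(\<And>i. expo a i = expo b i) \<Longrightarrow> a = b"
  by (rule poly_mapping_eqI) simp

lemma expo_add [simp]: "expo (a + b) i = expo a i + expo b i"
  by (simp add: lookup_add)

lemma expo_diff [simp]: "expo (a - b) i = expo a i - expo b i"
  by (simp add: lookup_minus)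

lemma vars_add [simp]: "vars (a + b) = vars a \<union> vars b"
  by (auto simp: in_vars_iff)

lemma expo_var_mon: "expo (var_mon i) j = (if i = j then 1 else 0)"
  by (simp add: var_mon_def lookup_single when_def)

lemma vars_var_mon [simp]: "vars (var_mon i) = {i}"
  by (simp add: var_mon_def)

lemma tdeg_0 [simp]: "tdeg 0 = 0"
  by (simp add: tdeg_def)

lemma tdeg_var_mon [simp]: "tdeg (var_mon i) = 1"
  by (simp add: tdeg_def var_mon_def)

lemma tdeg_eq_0_iff [simp]: "tdeg m = 0 \<longleftrightarrow> m = 0"
proof
  assume "tdeg m = 0"
  then have "\<forall>i\<in>vars m. expo m i = 0" by (simp add: tdeg_def)
  then show "m = 0" by (intro mon_eqI) (metis in_keys_iff lookup_zero)
qed simp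

lemma var_mon_minus:
  assumes "i \<in> vars m" shows "var_mon i + (m - var_mon i) = m"
  by (rule mon_eqI) (use assms in \<open>auto simp: expo_var_mon in_vars_iff\<close>)

lemma expo_le_tdeg: "expo m i \<le> tdeg m"
proof (cases "i \<in> vars m")
  case True then show ?thesis unfolding tdeg_def by (intro member_le_sum) auto
qed (simp add: in_vars_iff)

lemma vars_diff: "vars (a - b) \<subseteq> vars a"
  by (auto simp: in_vars_iff)

lemma var_mon_minus_iff: "var_mon i + (m - var_mon i) = m \<longleftrightarrow> i \<in> vars m"
proof
  assume "var_mon i + (m - var_mon i) = m"
  then have "vars (var_mon i + (m - var_mon i)) = vars m" by (rule arg_cong)
  then show "i \<in> vars m" by auto
qed (rule var_mon_minus)

lemma var_mon_neq_0 [simp]: "var_mon i \<noteq> 0"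
  by (metis tdeg_0 tdeg_var_mon zero_neq_one)

lemma tdeg_sum: "tdeg (sum f A) = (\<Sum>i\<in>A. tdeg (f i))"
  by (induction A rule: infinite_finite_induct) (auto simp: tdeg_add)

lemma mdeg_0 [simp]: "mdeg y 0 = 0"
  by (simp add: mdeg_def)

lemma mdeg_add: "mdeg y (a + b) = mdeg y a + mdeg y b"
  unfolding mdeg_def by (rule setsum_keys_plus_distrib) (auto simp: single_add)

lemma mdeg_var_mon: "mdeg y (var_mon i) = var_mon (y i)"
  by (simp add: mdeg_def var_mon_def)

lemma tdeg_single [simp]: "tdeg (Poly_Mapping.single a b) = b"
  by (cases "b = 0") (auto simp: tdeg_def)

lemma tdeg_mdeg [simp]: "tdeg (mdeg y m) = tdeg m"
  by (simp add: mdeg_def tdeg_sum) (simp add: tdeg_def)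

text \<open>
  The largest divisor of a monomial in the variables \<open>V\<close>.
\<close>

lift_definition part :: "'v set \<Rightarrow> 'v mon \<Rightarrow> 'v mon" is "\<lambda>V e i. if i \<in> V then e i else 0"
  by (rule finite_subset[rotated]) auto

lemma expo_part [simp]: "expo (part V m) i = (if i \<in> V then expo m i else 0)"
  by transfer simp

lemma vars_part [simp]: "vars (part V m) = vars m \<inter> V"
  by (auto simp: in_vars_iff split: if_splits)

lemma part_add [simp]: "part V (a + b) = part V a + part V b"
  by (rule mon_eqI) simp

lemma part_compl: "part V m + part (- V) m = m"
  by (rule mon_eqI) simp

lemma part_id: "vars m \<subseteq> V \<Longrightarrow> part V m = m"
  by (rule mon_eqI) (auto simp: in_vars_iff)

lemma part_zero: "vars m \<inter> V = {} \<Longrightarrow> part V m = 0"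
  by (rule mon_eqI) (auto simp: in_vars_iff)

lemma tdeg_part_le: "tdeg (part V m) \<le> tdeg m"
  by (metis part_compl tdeg_add le_add1)

lemma finite_box: "finite V \<Longrightarrow> finite {m. vars m \<subseteq> V \<and> (\<forall>i\<in>V. expo m i \<le> B)}"
proof -
  assume V: "finite V"
  let ?S = "{m. vars m \<subseteq> V \<and> (\<forall>i\<in>V. expo m i \<le> B)}"
  have "inj_on (\<lambda>m. restrict (expo m) V) ?S"
  proof (rule inj_onI, rule mon_eqI)
    fix a b i assume ab: "a \<in> ?S" "b \<in> ?S" and eq: "restrict (expo a) V = restrict (expo b) V"
    show "expo a i = expo b i"
    proof (cases "i \<in> V")
      case True then show ?thesis using fun_cong[OF eq, of i] by simp
    next
      case False then show ?thesis using ab in_vars_iff[of i a] in_vars_iff[of i b] by auto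
    qed
  qed
  moreover have "(\<lambda>m. restrict (expo m) V) ` ?S \<subseteq> (\<Pi>\<^sub>E i\<in>V. {..B})" by auto
  moreover have "finite (\<Pi>\<^sub>E i\<in>V. {..B})" using V by (intro finite_PiE) auto
  ultimately show "finite ?S" by (meson finite_imageD finite_subset)
qed

lemma finite_mons_tdeg_le: "finite V \<Longrightarrow> finite {m. vars m \<subseteq> V \<and> tdeg m \<le> d}"
  by (rule finite_subset[OF _ finite_box[of V d]]) (auto intro: order_trans[OF expo_le_tdeg])

lemma finite_mons_mdeg: "finite V \<Longrightarrow> finite {m. vars m \<subseteq> V \<and> mdeg y m = \<alpha>}"
  by (rule finite_subset[OF _ finite_mons_tdeg_le[of V "tdeg \<alpha>"]]) auto

text \<open>
  Listing the variables of a monomial with their multiplicities turns the monomials of degree \<open>d\<close> into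
  \<open>d\<close>-tuples of indices, although they involve infinitely many variables.
\<close>

lemma mon_eq_sum_vars: "\<exists>p. m = (\<Sum>j<tdeg m. var_mon (p j))"
proof (induction "tdeg m" arbitrary: m)
  case (Suc d)
  then have "m \<noteq> 0" by auto
  then obtain i where i: "i \<in> vars m" using in_vars_iff mon_eqI[of m 0] by fastforce
  let ?m = "m - var_mon i"
  have eq: "m = var_mon i + ?m" using var_mon_minus[OF i] by simp
  have d: "tdeg ?m = d" using Suc(2) arg_cong[OF eq, of tdeg] by (simp add: tdeg_add)
  then obtain p where p: "?m = (\<Sum>j<d. var_mon (p j))" using Suc(1)[of ?m] by auto
  have "m = (\<Sum>j<Suc d. var_mon ((p(d := i)) j))"
    using eq p by (simp add: add.commute)
  then show ?case using Suc(2) by auto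
qed (auto intro: sym)


section \<open>Monotone subsequences\<close>

text \<open>
  Refine the sequence one coordinate at a time, since every sequence of natural numbers has a
  nondecreasing subsequence. Both Dickson's lemma and the well-foundedness of a term order in a fixed
  degree follow by applying this to suitable coordinates.
\<close>

lemma simultaneous_mono_subseq:
  fixes s :: "nat \<Rightarrow> 'i \<Rightarrow> nat"
  assumes "finite A"
  shows "\<exists>f :: nat \<Rightarrow> nat. strict_mono f \<and> (\<forall>i\<in>A. \<forall>k l. k \<le> l \<longrightarrow> s (f k) i \<le> s (f l) i)"
  using assms
proof (induction A rule: finite_induct)
  case empty
  show ?case by (rule exI[of _ "\<lambda>n. n"]) (simp add: strict_mono_def)
next
  case (insert a A)
  then obtain f :: "nat \<Rightarrow> nat" where f: "strict_mono f" "\<forall>i\<in>A. \<forall>k l. k \<le> l \<longrightarrow> s (f k) i \<le> s (f l) i" by blast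
  have "\<exists>g :: nat \<Rightarrow> nat. strict_mono g \<and> (\<forall>k l. k \<le> l \<longrightarrow> s (f (g k)) a \<le> s (f (g l)) a)"
  proof -
    obtain h :: "nat \<Rightarrow> nat" where h: "strict_mono h" "monoseq (\<lambda>n. s (f (h n)) a)"
      using seq_monosub[of "\<lambda>n. s (f n) a"] by blast
    show ?thesis
    proof (cases "\<forall>k l. k \<le> l \<longrightarrow> s (f (h k)) a \<le> s (f (h l)) a")
      case False
      \<comment> \<open>A nonincreasing sequence of natural numbers is constant from its minimum on.\<close>
      with h(2) have dec: "\<And>k l. k \<le> l \<Longrightarrow> s (f (h l)) a \<le> s (f (h k)) a"
        by (auto simp: monoseq_def)
      obtain N where N: "\<And>k. s (f (h N)) a \<le> s (f (h k)) a"
        using ex_has_least_nat[of "\<lambda>_. True" 0 "\<lambda>k. s (f (h k)) a"] by blast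
      have "s (f (h (N + k))) a = s (f (h N)) a" for k
        using N[of "N + k"] dec[of N "N + k"] by simp
      then show ?thesis using h(1)
        by (intro exI[of _ "\<lambda>k. h (N + k)"]) (auto simp: strict_mono_def)
    qed (use h in blast)
  qed
  then obtain g :: "nat \<Rightarrow> nat" where g: "strict_mono g" "\<And>k l. k \<le> l \<Longrightarrow> s (f (g k)) a \<le> s (f (g l)) a"
    by blast
  have "k \<le> l \<Longrightarrow> g k \<le> g l" for k l
    using g(1) by (simp add: strict_mono_less_eq)
  with f g show ?case
    by (intro exI[of _ "f \<circ> g"]) (auto simp: strict_mono_def)
qed

text \<open>
  The minimal elements of \<open>U\<close> for divisibility suffice. If there were infinitely many, then some
  subsequence of them would have all exponents nondecreasing, so that one divides another.
\<close>

lemma dickson: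
  fixes U :: "'v mon set"
  assumes V: "finite V" and U: "\<And>m. m \<in> U \<Longrightarrow> vars m \<subseteq> V"
  shows "\<exists>F. finite F \<and> F \<subseteq> U \<and> (\<forall>m\<in>U. \<exists>b\<in>F. \<exists>c. m = b + c)"
proof -
  define F where "F = {m\<in>U. \<forall>b\<in>U. \<forall>c. m = b + c \<longrightarrow> b = m}"
  have "\<exists>b\<in>F. \<exists>c. m = b + c" if "m \<in> U" for m
    using that
  proof (induction "tdeg m" arbitrary: m rule: less_induct)
    case less
    show ?case
    proof (cases "m \<in> F")
      case True then show ?thesis by (metis add.right_neutral)
    next
      case False
      then obtain b c where b: "b \<in> U" "m = b + c" "b \<noteq> m" using less(2) by (auto simp: F_def)
      then have "tdeg b < tdeg m" by (auto simp: tdeg_add neq0_conv[symmetric] simp del: neq0_conv)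
      from less(1)[OF this b(1)] b(2) show ?thesis by (metis add.assoc)
    qed
  qed
  moreover have "finite F"
  proof (rule ccontr)
    assume "infinite F"
    then obtain s :: "nat \<Rightarrow> 'v mon" where s: "inj s" "range s \<subseteq> F"
      using infinite_countable_subset by blast
    obtain f :: "nat \<Rightarrow> nat" where f: "strict_mono f" "\<forall>i\<in>V. \<forall>k l. k \<le> l \<longrightarrow> expo (s (f k)) i \<le> expo (s (f l)) i"
      using simultaneous_mono_subseq[OF V, of "\<lambda>n. expo (s n)"] by blast
    have in_F: "s k \<in> F" for k using s(2) by blast
    have "expo (s (f 0)) i \<le> expo (s (f 1)) i" for i
    proof (cases "i \<in> V")
      case False
      then have "i \<notin> vars (s (f 0))" using U in_F by (auto simp: F_def)
      then show ?thesis by (simp add: in_vars_iff)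
    qed (use f in auto)
    then have "s (f 1) = s (f 0) + (s (f 1) - s (f 0))" by (intro mon_eqI) simp
    then have "s (f 0) = s (f 1)" using in_F[of "f 0"] in_F[of "f 1"] unfolding F_def by blast
    then have "f 0 = f 1" using s(1) by (auto dest: injD)
    with f(1) show False by (metis strict_mono_eq zero_neq_one)
  qed
  ultimately show ?thesis by (intro exI[of _ F]) (auto simp: F_def)
qed


section \<open>Coefficients\<close>

lemma coef_0 [simp]: "coef 0 m = 0"
  and coef_1: "coef 1 m = (if m = 0 then 1 else 0)"
  and coef_add [simp]: "coef (f + g) m = coef f m + coef g m"
  and coef_diff [simp]: "coef (f - g) m = coef f m - coef g m"
  and coef_uminus [simp]: "coef (- f) m = - coef f m"
  for f g :: "('v, 'a::comm_ring_1) mps"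
  by (simp_all add: zero_mps_def one_mps_def plus_mps_def minus_mps_def uminus_mps_def when_def)

lemma coef_mult: "coef (f * g) m = (\<Sum>(a, b)\<in>antidiag m. coef f a * coef g b)"
  for f g :: "('v, 'a::comm_ring_1) mps"
  by (simp add: times_mps_def)

lemma coef_sum: "coef (sum f A) m = (\<Sum>i\<in>A. coef (f i) m)"
  for f :: "_ \<Rightarrow> ('v, 'a::comm_ring_1) mps"
  by (induction A rule: infinite_finite_induct) auto

lemma coef_monomial: "coef (monomial a c) m = (if m = a then c else 0)"
  by (simp add: monomial_def when_def)

lemma supp_empty_iff: "supp f = {} \<longleftrightarrow> f = 0" for f :: "('v, 'a::comm_ring_1) mps"
  by (auto simp: supp_def intro: mps_eqI)

lemma in_antidiag [simp]: "(a, b) \<in> antidiag m \<longleftrightarrow> a + b = m"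
  by (simp add: antidiag_def)

lemma coef_monomial_mult:
  "coef (monomial a c * f) m = (if a + (m - a) = m then c * coef f (m - a) else 0)"
  for f :: "('v, 'a::comm_ring_1) mps"
proof -
  have "coef (monomial a c * f) m = (\<Sum>p\<in>antidiag m. if p = (a, m - a) then c * coef f (m - a) else 0)"
    unfolding coef_mult by (intro sum.cong) (auto simp: coef_monomial split: if_splits)
  then show ?thesis by simp
qed

lemma coef_scale [simp]: "coef (monomial 0 c * f) m = c * coef f m"
  for f :: "('v, 'a::comm_ring_1) mps"
  by (simp add: coef_monomial_mult)

lemma monomial_0_right [simp]: "monomial m 0 = (0 :: ('v, 'a::comm_ring_1) mps)"
  by (rule mps_eqI) (simp add: coef_monomial)

lemma monomial_mult: "monomial a c * monomial b d = monomial (a + b) (c * d)"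
  for c d :: "'a::comm_ring_1"
proof (rule mps_eqI)
  fix m
  have "a + (m - a) = m \<and> m - a = b \<longleftrightarrow> m = a + b" by auto
  then show "coef (monomial a c * monomial b d) m = coef (monomial (a + b) (c * d)) m"
    by (auto simp: coef_monomial_mult coef_monomial)
qed

lemma monomial_0_1 [simp]: "monomial 0 1 = (1 :: ('v, 'a::comm_ring_1) mps)"
  by (rule mps_eqI) (simp add: coef_monomial coef_1)

lemma supp_sum: "supp (sum f A) \<subseteq> (\<Union>i\<in>A. supp (f i))"
  for f :: "_ \<Rightarrow> ('v, 'a::comm_ring_1) mps"
  by (auto simp: supp_def coef_sum intro: ccontr)

lemma supp_sumE:
  fixes f :: "_ \<Rightarrow> ('v, 'a::comm_ring_1) mps"
  assumes "m \<in> supp (sum f A)" obtains i where "i \<in> A" "m \<in> supp (f i)"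
  using assms supp_sum[of f A] by blast

lemma supp_multE:
  fixes f g :: "('v, 'a::comm_ring_1) mps"
  assumes "m \<in> supp (f * g)" obtains u w where "m = u + w" "u \<in> supp f" "w \<in> supp g"
  using subsetD[OF supp_mult assms] by auto

lemma supp_monomial: "supp (monomial m c) = (if c = 0 then {} else {m})"
  by (auto simp: supp_def coef_monomial)

lemma supp_diff: "supp (f - g) \<subseteq> supp f \<union> supp g" for f g :: "('v, 'a::comm_ring_1) mps"
  by (auto simp: supp_def)

lemma homogeneous_0 [simp]: "homogeneous \<delta> d (0 :: ('v, 'a::comm_ring_1) mps)"
  by (simp add: homogeneous_def supp_0_1)

lemma homogeneous_add: "homogeneous \<delta> d f \<Longrightarrow> homogeneous \<delta> d g \<Longrightarrow> homogeneous \<delta> d (f + g)"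
  for f g :: "('v, 'a::comm_ring_1) mps"
  using supp_add[of f g] by (auto simp: homogeneous_def)

lemma homogeneous_diff: "homogeneous \<delta> d f \<Longrightarrow> homogeneous \<delta> d g \<Longrightarrow> homogeneous \<delta> d (f - g)"
  for f g :: "('v, 'a::comm_ring_1) mps"
  using supp_diff[of f g] by (auto simp: homogeneous_def)

lemma homogeneous_sum: "(\<And>i. i \<in> A \<Longrightarrow> homogeneous \<delta> d (f i)) \<Longrightarrow> homogeneous \<delta> d (sum f A)"
  for f :: "_ \<Rightarrow> ('v, 'a::comm_ring_1) mps"
  by (induction A rule: infinite_finite_induct) (auto intro: homogeneous_add)

lemma homogeneous_mult:
  "homogeneous tdeg d f \<Longrightarrow> homogeneous tdeg e g \<Longrightarrow> homogeneous tdeg (d + e) (f * g)"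
  for f g :: "('v, 'a::comm_ring_1) mps"
  using supp_mult[of f g] by (force simp: homogeneous_def tdeg_add)

lemma coef_component [simp]: "coef (component \<delta> d f) m = (if \<delta> m = d then coef f m else 0)"
  by (simp add: component_def when_def)

lemma homogeneous_component [simp]: "homogeneous \<delta> d (component \<delta> d f)"
  by (auto simp: homogeneous_def supp_def)

lemma component_id: "homogeneous \<delta> d f \<Longrightarrow> component \<delta> d f = f"
  by (rule mps_eqI) (auto simp: homogeneous_def supp_def)

lemma component_sum: "component \<delta> d (sum f A) = (\<Sum>i\<in>A. component \<delta> d (f i))"
  for f :: "_ \<Rightarrow> ('v, 'a::comm_ring_1) mps"
  by (rule mps_eqI) (simp add: coef_sum)

lemma component_mult_homogeneous:
  fixes r s :: "('v, 'a::comm_ring_1) mps"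
  assumes "homogeneous tdeg e s"
  shows "component tdeg d (r * s) = (if e \<le> d then component tdeg (d - e) r * s else 0)"
proof (rule mps_eqI)
  fix m
  have "(if tdeg m = d then coef r a * coef s b else 0)
      = (if e \<le> d \<and> tdeg a = d - e then coef r a * coef s b else 0)" if m: "a + b = m" for a b
  proof (cases "b \<in> supp s")
    case True
    then have "tdeg m = tdeg a + e"
      using assms m by (auto simp: homogeneous_def tdeg_add)
    then have "tdeg m = d \<longleftrightarrow> e \<le> d \<and> tdeg a = d - e" by arith
    then show ?thesis by simp
  qed (simp add: supp_def)
  then have "(\<Sum>(a, b)\<in>antidiag m. if tdeg m = d then coef r a * coef s b else 0)
      = (\<Sum>(a, b)\<in>antidiag m. if e \<le> d \<and> tdeg a = d - e then coef r a * coef s b else 0)"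
    by (intro sum.cong) auto
  moreover have "coef (component tdeg d (r * s)) m
      = (\<Sum>(a, b)\<in>antidiag m. if tdeg m = d then coef r a * coef s b else 0)"
    by (cases "tdeg m = d") (simp_all add: coef_mult)
  moreover have "coef (if e \<le> d then component tdeg (d - e) r * s else 0) m
      = (\<Sum>(a, b)\<in>antidiag m. if e \<le> d \<and> tdeg a = d - e then coef r a * coef s b else 0)"
    by (cases "e \<le> d") (auto simp: coef_mult intro!: sum.cong)
  ultimately show "coef (component tdeg d (r * s)) m
      = coef (if e \<le> d then component tdeg (d - e) r * s else 0) m"
    by simp
qed

lemma coef_trunc [simp]: "coef (trunc n f) m = (if vars m \<subseteq> {..<n} then coef f m else 0)"
  by (simp add: trunc_def when_def)

lemma supp_trunc: "supp (trunc n f) = {m\<in>supp f. vars m \<subseteq> {..<n}}"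
  by (auto simp: supp_def)

lemma trunc_add: "trunc n (f + g) = trunc n f + trunc n g"
  and trunc_component: "trunc n (component \<delta> d f) = component \<delta> d (trunc n f)"
  for f g :: "(nat, 'a::comm_ring_1) mps"
  by (rule mps_eqI, simp)+

lemma trunc_0 [simp]: "trunc n (0 :: (nat, 'a::comm_ring_1) mps) = 0"
  by (rule mps_eqI) simp

lemma trunc_sum: "trunc n (sum f A) = (\<Sum>i\<in>A. trunc n (f i))"
  for f :: "_ \<Rightarrow> (nat, 'a::comm_ring_1) mps"
  by (rule mps_eqI) (simp add: coef_sum)

lemma trunc_mult: "trunc n (f * g) = trunc n f * trunc n g" for f g :: "(nat, 'a::comm_ring_1) mps"
proof (rule mps_eqI)
  fix m
  show "coef (trunc n (f * g)) m = coef (trunc n f * trunc n g) m"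
  proof (cases "vars m \<subseteq> {..<n}")
    case True
    then have "vars a \<subseteq> {..<n} \<and> vars b \<subseteq> {..<n}" if "(a, b) \<in> antidiag m" for a b
      using that by auto
    then have "coef (trunc n f * trunc n g) m = (\<Sum>(a, b)\<in>antidiag m. coef f a * coef g b)"
      unfolding coef_mult by (intro sum.cong) auto
    with True show ?thesis by (simp add: coef_mult)
  next
    case False
    then have "\<not> (vars a \<subseteq> {..<n} \<and> vars b \<subseteq> {..<n})" if "(a, b) \<in> antidiag m" for a b
      using that by auto
    then have "coef (trunc n f * trunc n g) m = 0"
      unfolding coef_mult by (intro sum.neutral) fastforce
    with False show ?thesis by simp
  qed
qed

lemma trunc_polys: "f \<in> polys {..<n} \<Longrightarrow> trunc n f = f" for f :: "(nat, 'a::comm_ring_1) mps"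
  by (rule mps_eqI) (auto simp: polys_def supp_def)


section \<open>Term orders and leading monomials\<close>

text \<open>
  A relation rather than the function \<open>initial\<close>, which is meaningless for a series without largest
  monomial.
\<close>

definition is_lead :: "('v mon \<Rightarrow> 'v mon \<Rightarrow> bool) \<Rightarrow> ('v, 'a::zero) mps \<Rightarrow> 'v mon \<Rightarrow> bool" where
  "is_lead gt f m \<longleftrightarrow> m \<in> supp f \<and> (\<forall>m'\<in>supp f. m' \<noteq> m \<longrightarrow> gt m m')"

definition leads :: "('v mon \<Rightarrow> 'v mon \<Rightarrow> bool) \<Rightarrow> ('v, 'a::zero) mps set \<Rightarrow> 'v mon set" where
  "leads gt A = {m. \<exists>f\<in>A. is_lead gt f m}"

lemma leads_mono: "A \<subseteq> B \<Longrightarrow> leads gt A \<subseteq> leads gt B"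
  by (auto simp: leads_def)

locale term_ordered =
  fixes gt :: "nat mon \<Rightarrow> nat mon \<Rightarrow> bool"
  assumes term_order: "term_order gt"
begin

lemma gt_irrefl [simp]: "\<not> gt a a"
  using term_order by (auto simp: term_order_def irreflp_def)

lemma gt_trans: "gt a b \<Longrightarrow> gt b c \<Longrightarrow> gt a c"
  using term_order unfolding term_order_def transp_def by blast

lemma gt_asym: "gt a b \<Longrightarrow> \<not> gt b a"
  using gt_trans gt_irrefl by blast

lemma gt_total: "a \<noteq> b \<Longrightarrow> gt a b \<or> gt b a"
  using term_order unfolding term_order_def totalp_on_def by blast

lemma gt_add: "gt a b \<Longrightarrow> gt (a + c) (b + c)"
  using term_order unfolding term_order_def by blast

lemma ge_add: "a = b \<or> gt a b \<Longrightarrow> c = d \<or> gt c d \<Longrightarrow> a + c = b + d \<or> gt (a + c) (b + d)"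
  using gt_add[of a b c] gt_add[of c d b] gt_trans[of "a + c" "b + c" "b + d"]
  by (auto simp: add.commute)

lemma ge_sum:
  "finite A \<Longrightarrow> (\<And>i. i \<in> A \<Longrightarrow> f i = g i \<or> gt (f i) (g i)) \<Longrightarrow> sum f A = sum g A \<or> gt (sum f A) (sum g A)"
proof (induction A rule: finite_induct)
  case (insert x F)
  then show ?case using ge_add[of "f x" "g x" "sum f F" "sum g F"] by simp
qed simp

text \<open>
  There is no infinite chain of ever larger monomials of the same degree \<open>d\<close>, even though the monomials
  of degree \<open>d\<close> are infinite in number. Number the variables in decreasing order and regard the members of such a
  chain as \<open>d\<close>-tuples of positions. On a subsequence all \<open>d\<close> positions are nondecreasing, hence the
  variables, and with them the monomials, are nonincreasing. Thus leading monomials exist, and the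
  coefficients of quotients can be computed by recursion from larger to smaller monomials.
\<close>

lemma wf_gt: "wf {(a, b). gt a b \<and> tdeg a = tdeg b}"
  unfolding wf_iff_no_infinite_down_chain
proof
  assume "\<exists>s. \<forall>i. (s (Suc i), s i) \<in> {(a, b). gt a b \<and> tdeg a = tdeg b}"
  then obtain s where s: "\<And>i. gt (s (Suc i)) (s i)" "\<And>i. tdeg (s (Suc i)) = tdeg (s i)" by auto
  define d where "d = tdeg (s 0)"
  have d: "tdeg (s i) = d" for i
    by (induction i) (auto simp: d_def s(2))
  have inc: "gt (s l) (s k)" if "k < l" for k l
    using that by (induction l) (auto simp: less_Suc_eq intro: s(1) gt_trans)
  obtain \<sigma> :: "nat \<Rightarrow> nat" where \<sigma>: "bij \<sigma>" "\<And>i j. gt (var_mon (\<sigma> i)) (var_mon (\<sigma> j)) \<longleftrightarrow> i < j"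
    using term_order unfolding term_order_def by blast
  have "\<exists>q. s k = (\<Sum>j<d. var_mon (\<sigma> (q j)))" for k
  proof -
    obtain p where "s k = (\<Sum>j<d. var_mon (p j))" using mon_eq_sum_vars[of "s k"] d by auto
    then show ?thesis
      using \<sigma>(1)
      by (intro exI[of _ "\<lambda>j. inv_into UNIV \<sigma> (p j)"]) (simp add: bij_is_surj surj_f_inv_f)
  qed
  then obtain q where q: "\<And>k. s k = (\<Sum>j<d. var_mon (\<sigma> (q k j)))" by metis
  obtain f :: "nat \<Rightarrow> nat" where f: "strict_mono f" "\<forall>j\<in>{..<d}. \<forall>k l. k \<le> l \<longrightarrow> q (f k) j \<le> q (f l) j"
    using simultaneous_mono_subseq[of "{..<d}" q] by blast
  have "s (f 0) = s (f 1) \<or> gt (s (f 0)) (s (f 1))"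
    unfolding q[of "f 0"] q[of "f 1"]
  proof (rule ge_sum)
    fix j assume "j \<in> {..<d}"
    then have "q (f 0) j \<le> q (f 1) j" using f(2) by simp
    then show "var_mon (\<sigma> (q (f 0) j)) = var_mon (\<sigma> (q (f 1) j)) \<or>
        gt (var_mon (\<sigma> (q (f 0) j))) (var_mon (\<sigma> (q (f 1) j)))"
      by (auto simp: \<sigma>(2) le_less)
  qed simp
  moreover have "gt (s (f 1)) (s (f 0))"
    using f(1) by (intro inc) (simp add: strict_mono_def)
  ultimately show False using gt_asym gt_irrefl by metis
qed

lemma ex_max:
  assumes "A \<noteq> {}" "\<And>m. m \<in> A \<Longrightarrow> tdeg m = d"
  shows "\<exists>m\<in>A. \<forall>m'\<in>A. m' \<noteq> m \<longrightarrow> gt m m'"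
proof -
  obtain a where "a \<in> A" using assms(1) by blast
  then obtain m where m: "m \<in> A" "\<forall>b. gt b m \<and> tdeg b = tdeg m \<longrightarrow> b \<notin> A"
    using wf_gt unfolding wf_eq_minimal by (auto dest!: spec[of _ A])
  have "gt m m'" if "m' \<in> A" "m' \<noteq> m" for m'
  proof -
    have "tdeg m' = tdeg m" by (simp only: assms(2)[OF that(1)] assms(2)[OF m(1)])
    then have "\<not> gt m' m" using m(2) that(1) by metis
    with gt_total[OF that(2)] show ?thesis by simp
  qed
  with m(1) show ?thesis by metis
qed

lemma is_lead_unique: "is_lead gt f m \<Longrightarrow> is_lead gt f m' \<Longrightarrow> m = m'"
  unfolding is_lead_def by (metis gt_asym)

lemma initial_eq:
  assumes "is_lead gt f m" shows "initial gt f = m"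
  unfolding initial_def is_lead_def[symmetric]
  by (rule the_equality) (fact assms, rule is_lead_unique[OF _ assms])

lemma ex_lead:
  fixes f :: "(nat, 'a::comm_ring_1) mps"
  assumes "homogeneous tdeg d f" "f \<noteq> 0"
  shows "\<exists>m. is_lead gt f m"
proof -
  have "supp f \<noteq> {}" "\<And>m. m \<in> supp f \<Longrightarrow> tdeg m = d"
    using assms by (simp_all add: supp_empty_iff homogeneous_def)
  from ex_max[OF this] show ?thesis by (auto simp: is_lead_def)
qed

lemma is_lead_monomial_mult:
  fixes f :: "(nat, 'a::comm_ring_1) mps"
  assumes "is_lead gt f m"
  shows "is_lead gt (monomial u 1 * f) (u + m)"
  unfolding is_lead_def
proof (intro conjI ballI impI)
  show "u + m \<in> supp (monomial u 1 * f)"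
    using assms by (simp add: is_lead_def supp_def coef_monomial_mult)
next
  fix m' assume m': "m' \<in> supp (monomial u 1 * f)" "m' \<noteq> u + m"
  then obtain b where b: "m' = u + b" "b \<in> supp f"
    using subsetD[OF supp_mult m'(1)] by (auto simp: supp_monomial split: if_splits)
  then have "gt m b" using assms m'(2) by (auto simp: is_lead_def)
  then show "gt (u + m) m'" using gt_add[of m b u] b(1) by (simp add: add.commute)
qed

lemma is_lead_trunc:
  "is_lead gt f m \<Longrightarrow> vars m \<subseteq> {..<n} \<Longrightarrow> is_lead gt (trunc n f) m"
  by (auto simp: is_lead_def supp_trunc)

lemma is_lead_component: "is_lead gt f m \<Longrightarrow> is_lead gt (component \<delta> (\<delta> m) f) m"
  by (auto simp: is_lead_def supp_def split: if_splits)

end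


section \<open>Linear subspaces and their leading monomials\<close>

definition linear_set :: "('v, 'a::comm_ring_1) mps set \<Rightarrow> bool" where
  "linear_set T \<longleftrightarrow> 0 \<in> T \<and> (\<forall>f\<in>T. \<forall>g\<in>T. f + g \<in> T) \<and> (\<forall>f\<in>T. \<forall>c. monomial 0 c * f \<in> T)"

lemma linear_setD:
  assumes "linear_set T"
  shows "0 \<in> T" "f \<in> T \<Longrightarrow> g \<in> T \<Longrightarrow> f + g \<in> T" "f \<in> T \<Longrightarrow> monomial 0 c * f \<in> T"
  using assms by (simp_all add: linear_set_def)

lemma linear_set_sum: "linear_set T \<Longrightarrow> (\<And>i. i \<in> A \<Longrightarrow> f i \<in> T) \<Longrightarrow> sum f A \<in> T"
  by (induction A rule: infinite_finite_induct) (auto intro: linear_setD)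

lemma linear_set_diff:
  assumes "linear_set T" "f \<in> T" "g \<in> T" shows "f - g \<in> T"
proof -
  have eq: "f - g = f + monomial 0 (- 1) * g" by (rule mps_eqI) simp
  show ?thesis unfolding eq
    by (rule linear_setD(2)[OF assms(1,2) linear_setD(3)[OF assms(1,3)]])
qed

definition span_over :: "('v, 'a::comm_ring_1) mps set \<Rightarrow> ('v, 'a) mps set \<Rightarrow> ('v, 'a) mps set" where
  "span_over T E = {t + (\<Sum>e\<in>E. monomial 0 (c e) * e) | t c. t \<in> T}"

lemma span_overI: "t \<in> T \<Longrightarrow> t + (\<Sum>e\<in>E. monomial 0 (c e) * e) \<in> span_over T E"
  unfolding span_over_def by (rule CollectI, rule exI[of _ t], rule exI[of _ c], rule conjI[OF refl])

lemma span_overE: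
  assumes "f \<in> span_over T E"
  obtains t c where "t \<in> T" "f = t + (\<Sum>e\<in>E. monomial 0 (c e) * e)"
  using assms unfolding span_over_def by (elim CollectE exE conjE)

lemma span_over_superset: "t \<in> T \<Longrightarrow> t \<in> span_over T E"
  using span_overI[of t T "\<lambda>_. 0" E] by simp

lemma monomial_0_add: "monomial 0 (a + b) = monomial 0 a + (monomial 0 b :: ('v, 'a::comm_ring_1) mps)"
  by (rule mps_eqI) (simp add: coef_monomial)

lemma monomial_0_mult: "monomial 0 (a * b) = monomial 0 a * (monomial 0 b :: ('v, 'a::comm_ring_1) mps)"
  by (simp add: monomial_mult)

lemma linear_set_span_over:
  assumes "linear_set T" shows "linear_set (span_over T E)"
  unfolding linear_set_def
proof (intro conjI ballI allI)
  show "0 \<in> span_over T E"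
    by (rule span_over_superset[OF linear_setD(1)[OF assms]])
next
  fix f g assume "f \<in> span_over T E" "g \<in> span_over T E"
  then obtain t c t' c' where *: "t \<in> T" "t' \<in> T" "f = t + (\<Sum>e\<in>E. monomial 0 (c e) * e)"
    "g = t' + (\<Sum>e\<in>E. monomial 0 (c' e) * e)" by (elim span_overE)
  then have "f + g = (t + t') + (\<Sum>e\<in>E. monomial 0 (c e + c' e) * e)"
    by (simp add: monomial_0_add distrib_right sum.distrib)
  then show "f + g \<in> span_over T E"
    using span_overI[OF linear_setD(2)[OF assms *(1,2)], where c = "\<lambda>e. c e + c' e"] by simp
next
  fix f k assume "f \<in> span_over T E"
  then obtain t c where *: "t \<in> T" "f = t + (\<Sum>e\<in>E. monomial 0 (c e) * e)" by (elim span_overE)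
  then have "monomial 0 k * f = monomial 0 k * t + (\<Sum>e\<in>E. monomial 0 (k * c e) * e)"
    by (simp only: distrib_left sum_distrib_left monomial_0_mult mult.assoc)
  then show "monomial 0 k * f \<in> span_over T E"
    using span_overI[OF linear_setD(3)[OF assms *(1)], where c = "\<lambda>e. k * c e"] by simp
qed

lemma span_over_generator:
  assumes "linear_set T" "finite E" "e \<in> E"
  shows "e \<in> span_over T E"
proof -
  have "(\<Sum>x\<in>E. monomial 0 (if x = e then 1 else 0) * x) = (\<Sum>x\<in>E. if x = e then e else 0)"
    by (intro sum.cong) auto
  then have "(\<Sum>x\<in>E. monomial 0 (if x = e then 1 else 0) * x) = e"
    using assms(2,3) by simp
  then show ?thesis
    using span_overI[OF linear_setD(1)[OF assms(1)], where c = "\<lambda>x. if x = e then 1 else 0" and E = E] by simp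
qed

lemma span_over_insert:
  assumes "finite E" "e \<notin> E"
  shows "span_over T (insert e E) \<subseteq> {f + monomial 0 c * e | f c. f \<in> span_over T E}"
proof
  fix f assume "f \<in> span_over T (insert e E)"
  then obtain t c where *: "t \<in> T" "f = t + (\<Sum>x\<in>insert e E. monomial 0 (c x) * x)"
    by (elim span_overE)
  then have "f = (t + (\<Sum>x\<in>E. monomial 0 (c x) * x)) + monomial 0 (c e) * e"
    using assms by simp
  with span_overI[OF *(1)] show "f \<in> {f + monomial 0 c * e | f c. f \<in> span_over T E}" by blast
qed

context term_ordered begin

text \<open>
  Suppose that two new leading monomials \<open>m1 > m2\<close> occur. Eliminating \<open>e\<close> between the two elements yields
  an element of \<open>T\<close> that still has leading monomial \<open>m1\<close>, so \<open>m1\<close> was not new.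
\<close>

lemma leads_adjoin_one:
  fixes T :: "(nat, 'k::field) mps set"
  assumes T: "linear_set T"
  shows "finite (leads gt {t + monomial 0 c * e | t c. t \<in> T} - leads gt T)"
proof -
  let ?L = "leads gt {t + monomial 0 c * e | t c. t \<in> T} - leads gt T"
  have no: False if m: "m1 \<in> ?L" "m2 \<in> ?L" "gt m1 m2" for m1 m2
  proof -
    obtain t1 c1 t2 c2 where t: "t1 \<in> T" "t2 \<in> T"
      and l: "is_lead gt (t1 + monomial 0 c1 * e) m1" "is_lead gt (t2 + monomial 0 c2 * e) m2"
      using m by (auto simp: leads_def)
    have c: "c1 \<noteq> 0" "c2 \<noteq> 0"
      using l t m by (auto simp: leads_def)
    \<comment> \<open>The combination of the two elements in which \<open>e\<close> cancels.\<close>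
    let ?f = "monomial 0 c2 * t1 - monomial 0 c1 * t2"
    have f: "coef ?f m = c2 * coef (t1 + monomial 0 c1 * e) m - c1 * coef (t2 + monomial 0 c2 * e) m" for m
      by simp (simp add: algebra_simps)
    have "is_lead gt ?f m1"
      unfolding is_lead_def
    proof (intro conjI ballI impI)
      have "m1 \<notin> supp (t2 + monomial 0 c2 * e)"
        using l(2) m(3) gt_asym gt_irrefl unfolding is_lead_def by metis
      then show "m1 \<in> supp ?f"
        using l(1) c(2) by (simp only: supp_def f mem_Collect_eq is_lead_def) simp
    next
      fix m' assume m': "m' \<in> supp ?f" "m' \<noteq> m1"
      then have "m' \<in> supp (t1 + monomial 0 c1 * e) \<or> m' \<in> supp (t2 + monomial 0 c2 * e)"
        by (simp only: supp_def f mem_Collect_eq) auto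
      then show "gt m1 m'"
        using l m(3) m'(2) gt_trans unfolding is_lead_def by metis
    qed
    moreover have "?f \<in> T"
      using linear_set_diff[OF T] linear_setD(3)[OF T] t by simp
    ultimately show False using m(1) by (auto simp: leads_def)
  qed
  show ?thesis
  proof (cases "?L = {}")
    case False
    then obtain m where "m \<in> ?L" by blast
    then have "?L \<subseteq> {m}" using no gt_total by blast
    then show ?thesis by (rule finite_subset) simp
  next
    case True
    then show ?thesis by (simp only: finite.emptyI)
  qed
qed

lemma finite_new_leads:
  fixes T :: "(nat, 'k::field) mps set"
  assumes T: "linear_set T" and E: "finite E"
  shows "finite (leads gt (span_over T E) - leads gt T)"
  using E
proof (induction E rule: finite_induct)
  case empty
  have "span_over T {} = T" by (auto simp: span_over_def)
  then show ?case by simp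
next
  case (insert e E)
  let ?L = "leads gt {f + monomial 0 c * e | f c. f \<in> span_over T E}"
  have "leads gt (span_over T (insert e E)) - leads gt T
      \<subseteq> (?L - leads gt (span_over T E)) \<union> (leads gt (span_over T E) - leads gt T)"
    using leads_mono[OF span_over_insert[OF insert(1,2)]] by blast
  moreover have "finite (?L - leads gt (span_over T E))"
    by (rule leads_adjoin_one[OF linear_set_span_over[OF T]])
  ultimately show ?case using insert(3) finite_subset by blast
qed

end


section \<open>Division with infinite sums\<close>

text \<open>
  Dividing by the family \<open>\<gamma>\<close> rewrites the multiples of the monomials in \<open>B\<close> by monomials without variables
  in \<open>V\<close>. Such a multiple \<open>b + u\<close> determines \<open>b\<close> as its part in \<open>V\<close>, so that division by \<open>\<gamma>\<close> involves
  no choice between different \<open>b\<close>.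
\<close>

locale monic_family = term_ordered gt for gt +
  fixes V :: "nat set" and B :: "nat mon set" and \<gamma> :: "nat mon \<Rightarrow> (nat, 'k::field) mps"
  assumes finite_B: "finite B"
    and vars_B: "b \<in> B \<Longrightarrow> vars b \<subseteq> V"
    and lead_\<gamma>: "b \<in> B \<Longrightarrow> is_lead gt (\<gamma> b) b"
    and monic_\<gamma>: "b \<in> B \<Longrightarrow> coef (\<gamma> b) b = 1"
    and homogeneous_\<gamma>: "b \<in> B \<Longrightarrow> homogeneous tdeg (tdeg b) (\<gamma> b)"
begin

definition quotients :: "nat \<Rightarrow> (nat mon \<Rightarrow> (nat, 'k) mps) \<Rightarrow> bool" where
  "quotients d h \<longleftrightarrow> (\<forall>b\<in>B. \<forall>u\<in>supp (h b). vars u \<inter> V = {} \<and> tdeg u + tdeg b = d)"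

definition combs :: "nat \<Rightarrow> (nat, 'k) mps set" where
  "combs d = {\<Sum>b\<in>B. h b * \<gamma> b | h. quotients d h}"

lemma combsI: "quotients d h \<Longrightarrow> (\<Sum>b\<in>B. h b * \<gamma> b) \<in> combs d"
  by (auto simp: combs_def)

lemma part_of_product:
  "b \<in> B \<Longrightarrow> vars u \<inter> V = {} \<Longrightarrow> part V (b + u) = b"
  by (simp add: part_id[OF vars_B] part_zero)

text \<open>
  Only the term with \<open>b = b0\<close> and \<open>u = u0\<close> uses a leading coefficient of the family; every other
  nonzero term comes from a larger product \<open>b + u\<close>. This shows both that the largest product is not
  cancelled and that the quotients can be determined by a triangular recursion.
\<close>

lemma coef_comb:
  assumes h: "quotients d h" and b0: "b0 \<in> B" "vars u0 \<inter> V = {}"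
  shows "coef (\<Sum>b\<in>B. h b * \<gamma> b) (b0 + u0) = coef (h b0) u0 +
    (\<Sum>b\<in>B. \<Sum>(u, w)\<in>antidiag (b0 + u0). if gt (b + u) (b0 + u0) then coef (h b) u * coef (\<gamma> b) w else 0)"
proof -
  let ?m = "b0 + u0"
  have summand: "coef (h b) u * coef (\<gamma> b) w =
      (if (b, u, w) = (b0, u0, b0) then coef (h b0) u0 else 0) +
      (if gt (b + u) ?m then coef (h b) u * coef (\<gamma> b) w else 0)"
    if b: "b \<in> B" and uw: "(u, w) \<in> antidiag ?m" for b u w
  proof (cases "w = b")
    case True
    then have "\<not> gt (b + u) ?m" using uw by (simp add: add.commute)
    moreover have "(b, u, w) = (b0, u0, b0)" if "u \<in> supp (h b)"
    proof -
      have "vars u \<inter> V = {}" using that h b by (auto simp: quotients_def)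
      then have "part V (b + u) = b" by (rule part_of_product[OF b])
      moreover have "b + u = ?m" using uw True by (simp add: add.commute)
      ultimately have "b = b0" using part_of_product[OF b0] by metis
      with uw True show ?thesis by (auto simp: add.commute)
    qed
    ultimately show ?thesis
      using monic_\<gamma>[OF b] True by (cases "u \<in> supp (h b)") (auto simp: supp_def)
  next
    case False
    have "gt (b + u) ?m" if "w \<in> supp (\<gamma> b)"
      using lead_\<gamma>[OF b] that False uw gt_add[of b w u] by (auto simp: is_lead_def add.commute)
    moreover have "(b, u, w) \<noteq> (b0, u0, b0)" using False by auto
    ultimately show ?thesis by (cases "w \<in> supp (\<gamma> b)") (auto simp: supp_def)
  qed
  have "(\<Sum>(u, w)\<in>antidiag ?m. if (b, u, w) = (b0, u0, b0) then coef (h b0) u0 else 0)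
      = (\<Sum>p\<in>antidiag ?m. if p = (u0, b0) then (if b = b0 then coef (h b0) u0 else 0) else 0)" for b
    by (intro sum.cong) (auto split: if_splits)
  also have "\<dots> b = (if b = b0 then coef (h b0) u0 else 0)" for b
    by (simp add: add.commute)
  finally have "(\<Sum>b\<in>B. \<Sum>(u, w)\<in>antidiag ?m. if (b, u, w) = (b0, u0, b0) then coef (h b0) u0 else 0)
      = coef (h b0) u0"
    using b0(1) finite_B by simp
  moreover have "coef (\<Sum>b\<in>B. h b * \<gamma> b) ?m =
      (\<Sum>b\<in>B. \<Sum>(u, w)\<in>antidiag ?m. (if (b, u, w) = (b0, u0, b0) then coef (h b0) u0 else 0) +
      (if gt (b + u) ?m then coef (h b) u * coef (\<gamma> b) w else 0))"
    unfolding coef_sum coef_mult using summand by (intro sum.cong refl) auto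
  ultimately show ?thesis
    by (simp add: sum.distrib case_prod_unfold)
qed

text \<open>
  The largest of the products \<open>b + u\<close> that occur is not cancelled, so it is the leading monomial.
\<close>

lemma leads_combs:
  assumes m: "m \<in> leads gt (combs d)" shows "part V m \<in> B"
proof -
  obtain h where h: "quotients d h" and l: "is_lead gt (\<Sum>b\<in>B. h b * \<gamma> b) m" (is "is_lead gt ?f m")
    using m by (auto simp: leads_def combs_def)
  \<comment> \<open>Each monomial of the combination lies weakly below one of these products.\<close>
  define A where "A = {b + u | b u. b \<in> B \<and> u \<in> supp (h b)}"
  have below: "\<exists>a\<in>A. a = m' \<or> gt a m'" if "m' \<in> supp ?f" for m'
  proof -
    obtain b where b: "b \<in> B" "m' \<in> supp (h b * \<gamma> b)"
      using \<open>m' \<in> supp ?f\<close> by (rule supp_sumE)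
    obtain u w where uw: "m' = u + w" "u \<in> supp (h b)" "w \<in> supp (\<gamma> b)"
      using b(2) by (rule supp_multE)
    have "b = w \<or> gt b w" using lead_\<gamma>[OF b(1)] uw(3) by (auto simp: is_lead_def)
    then have "b + u = m' \<or> gt (b + u) m'" using gt_add[of b w u] uw(1) by (auto simp: add.commute)
    with b(1) uw(2) show ?thesis unfolding A_def by blast
  qed
  have m_supp: "m \<in> supp ?f" using l by (simp add: is_lead_def)
  have "A \<noteq> {}" using below[OF m_supp] by blast
  moreover have "tdeg a = d" if "a \<in> A" for a
    using that h by (auto simp: A_def quotients_def tdeg_add add.commute)
  ultimately obtain a where a: "a \<in> A" "\<forall>a'\<in>A. a' \<noteq> a \<longrightarrow> gt a a'"
    using ex_max[of A d] by blast
  then obtain b0 u0 where b0: "a = b0 + u0" "b0 \<in> B" "u0 \<in> supp (h b0)" by (auto simp: A_def)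
  have u0: "vars u0 \<inter> V = {}" using b0 h by (auto simp: quotients_def)
  have "\<not> gt (b + u) a" if "b \<in> B" "u \<in> supp (h b)" for b u
  proof -
    have "b + u \<in> A" using that unfolding A_def by blast
    then show ?thesis using a(2) gt_asym gt_irrefl by metis
  qed
  then have "(\<Sum>b\<in>B. \<Sum>(u, w)\<in>antidiag a. if gt (b + u) a then coef (h b) u * coef (\<gamma> b) w else 0) = 0"
    by (intro sum.neutral ballI) (fastforce simp: supp_def)
  then have "coef ?f a = coef (h b0) u0"
    using coef_comb[OF h b0(2) u0] b0(1) by simp
  then have "a \<in> supp ?f" using b0(3) by (simp add: supp_def)
  have "a = m"
  proof (rule ccontr)
    assume "a \<noteq> m"
    then have "gt m a" using l \<open>a \<in> supp ?f\<close> by (simp add: is_lead_def)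
    moreover obtain a' where "a' \<in> A" "a' = m \<or> gt a' m" using below[OF m_supp] by blast
    ultimately show False using a(2) gt_trans gt_asym gt_irrefl by metis
  qed
  then show ?thesis using part_of_product[OF b0(2) u0] b0(1,2) by simp
qed

lemma homogeneous_combs: "f \<in> combs d \<Longrightarrow> homogeneous tdeg d f"
proof -
  assume "f \<in> combs d"
  then obtain h where h: "quotients d h" "f = (\<Sum>b\<in>B. h b * \<gamma> b)" by (auto simp: combs_def)
  have "homogeneous tdeg d (h b * \<gamma> b)" if b: "b \<in> B" for b
    unfolding homogeneous_def
  proof
    fix m assume "m \<in> supp (h b * \<gamma> b)"
    then obtain u w where "m = u + w" "u \<in> supp (h b)" "w \<in> supp (\<gamma> b)"
      by (rule supp_multE)
    then show "tdeg m = d"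
      using h(1) b homogeneous_\<gamma>[OF b] by (auto simp: quotients_def homogeneous_def tdeg_add)
  qed
  with h(2) show ?thesis by (simp add: homogeneous_sum)
qed

lemma linear_set_combs: "linear_set (combs d)"
  unfolding linear_set_def
proof (intro conjI ballI allI)
  show "0 \<in> combs d" unfolding combs_def
    by (auto intro!: exI[of _ "\<lambda>_. 0"] simp: quotients_def supp_0_1)
next
  fix f g assume "f \<in> combs d" "g \<in> combs d"
  then obtain h k where *: "quotients d h" "quotients d k" "f = (\<Sum>b\<in>B. h b * \<gamma> b)" "g = (\<Sum>b\<in>B. k b * \<gamma> b)"
    by (auto simp: combs_def)
  have "quotients d (\<lambda>b. h b + k b)"
    unfolding quotients_def
  proof (intro ballI)
    fix b u assume b: "b \<in> B" and "u \<in> supp (h b + k b)"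
    then have "u \<in> supp (h b) \<or> u \<in> supp (k b)" using supp_add[of "h b" "k b"] by blast
    with b *(1,2) show "vars u \<inter> V = {} \<and> tdeg u + tdeg b = d" unfolding quotients_def by blast
  qed
  moreover have "f + g = (\<Sum>b\<in>B. (h b + k b) * \<gamma> b)" using * by (simp add: distrib_right sum.distrib)
  ultimately show "f + g \<in> combs d" using combsI by simp
next
  fix f c assume "f \<in> combs d"
  then obtain h where *: "quotients d h" "f = (\<Sum>b\<in>B. h b * \<gamma> b)" by (auto simp: combs_def)
  have "quotients d (\<lambda>b. monomial 0 c * h b)" using *(1) by (auto simp: quotients_def supp_def)
  moreover have "monomial 0 c * f = (\<Sum>b\<in>B. (monomial 0 c * h b) * \<gamma> b)"
    using * by (simp add: sum_distrib_left mult.assoc)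
  ultimately show "monomial 0 c * f \<in> combs d" using combsI by simp
qed

text \<open>
  By \<open>coef_comb\<close>, the requirement that \<open>f\<close> and its quotient part have equal coefficients at \<open>m = b + u\<close>
  expresses the coefficient of \<open>u\<close> in \<open>h b\<close> by those that belong to larger products. The resulting sum
  is finite because only divisors \<open>u\<close> of \<open>m\<close> enter, although infinitely many monomials of the same
  degree may be larger than \<open>m\<close>.
\<close>

lemma division:
  assumes f: "homogeneous tdeg d f"
  shows "\<exists>q\<in>combs d. \<forall>m\<in>supp (f - q). part V m \<notin> B"
proof -
  let ?R = "{(a, b). gt a b \<and> tdeg a = tdeg b}"
  \<comment> \<open>The solution \<open>a (b + u)\<close> of this recursion becomes the coefficient of \<open>u\<close> in \<open>h b\<close>.\<close>
  define H where "H = (\<lambda>(a :: nat mon \<Rightarrow> 'k) m. coef f m - (\<Sum>b\<in>B. \<Sum>(u, w)\<in>antidiag m.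
    if (b + u, m) \<in> ?R \<and> vars u \<inter> V = {} then a (b + u) * coef (\<gamma> b) w else 0))"
  define a where "a = wfrec ?R H"
  have a: "a m = H a m" for m
  proof -
    have "a m = H (cut a ?R m) m" unfolding a_def by (rule wfrec[OF wf_gt])
    also have "\<dots> = H a m"
      unfolding H_def by (intro arg_cong2[where f = "(-)"] refl sum.cong) (auto simp: cut_apply)
    finally show ?thesis .
  qed
  define h where "h = (\<lambda>b. MPS (\<lambda>u. if vars u \<inter> V = {} \<and> tdeg u + tdeg b = d then a (b + u) else 0))"
  have h: "quotients d h" by (auto simp: quotients_def h_def supp_def split: if_splits)
  let ?q = "\<Sum>b\<in>B. h b * \<gamma> b"
  have q: "?q \<in> combs d" using h by (auto simp: combs_def)
  have "coef (f - ?q) m = 0" if "part V m \<in> B" for m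
  proof (cases "tdeg m = d")
    case True
    define b0 u0 where "b0 = part V m" and "u0 = part (- V) m"
    have m: "m = b0 + u0" using part_compl[of V m] by (simp add: b0_def u0_def)
    have b0: "b0 \<in> B" "vars u0 \<inter> V = {}" using that by (auto simp: b0_def u0_def)
    have d: "tdeg b0 + tdeg u0 = d" using True m by (simp add: tdeg_add)
    have "(if gt (b + u) m then coef (h b) u * coef (\<gamma> b) w else 0)
        = (if (b + u, m) \<in> ?R \<and> vars u \<inter> V = {} then a (b + u) * coef (\<gamma> b) w else 0)" for b u w
      using True by (auto simp: h_def tdeg_add)
    then have "coef ?q m = a m + (\<Sum>b\<in>B. \<Sum>(u, w)\<in>antidiag m.
        if (b + u, m) \<in> ?R \<and> vars u \<inter> V = {} then a (b + u) * coef (\<gamma> b) w else 0)"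
      using coef_comb[OF h b0] b0(2) d m by (simp add: h_def add.commute)
    also have "\<dots> = coef f m" by (subst a) (simp add: H_def)
    finally show ?thesis by simp
  next
    case False
    then have "m \<notin> supp f" "m \<notin> supp ?q"
      using f homogeneous_combs[OF q] by (auto simp: homogeneous_def)
    then show ?thesis by (simp add: supp_def)
  qed
  then have "\<forall>m\<in>supp (f - ?q). part V m \<notin> B" by (auto simp: supp_def)
  with q show ?thesis by blast
qed

end


section \<open>Infinite sums of multiples of variables\<close>

text \<open>
  This is the formal sum of \<open>x\<^sub>j q\<^sub>j\<close> over the possibly infinite set \<open>W\<close>; it exists for arbitrary
  series \<open>q\<^sub>j\<close> because only the finitely many variables dividing \<open>m\<close> contribute at \<open>m\<close>.
\<close>

definition var_sum :: "'v set \<Rightarrow> ('v \<Rightarrow> ('v, 'a::comm_ring_1) mps) \<Rightarrow> ('v, 'a) mps" where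
  "var_sum W q = MPS (\<lambda>m. \<Sum>j\<in>vars m \<inter> W. coef (q j) (m - var_mon j))"

lemma coef_var_sum: "coef (var_sum W q) m = (\<Sum>j\<in>vars m \<inter> W. coef (q j) (m - var_mon j))"
  by (simp add: var_sum_def)

lemma supp_var_sum: "supp (var_sum W q) \<subseteq> (\<Union>j\<in>W. (+) (var_mon j) ` supp (q j))"
proof
  fix m assume "m \<in> supp (var_sum W q)"
  then have "(\<Sum>j\<in>vars m \<inter> W. coef (q j) (m - var_mon j)) \<noteq> 0" by (simp add: supp_def coef_var_sum)
  then obtain j where j: "j \<in> vars m \<inter> W" "coef (q j) (m - var_mon j) \<noteq> 0"
    by (rule sum.not_neutral_contains_not_neutral)
  then show "m \<in> (\<Union>j\<in>W. (+) (var_mon j) ` supp (q j))"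
    using var_mon_minus[of j m] by (auto simp: supp_def intro!: bexI[of _ j] image_eqI[of _ _ "m - var_mon j"])
qed

lemma var_sum_sum: "var_sum W (\<lambda>j. \<Sum>i\<in>A. q i j) = (\<Sum>i\<in>A. var_sum W (q i))"
  by (rule mps_eqI) (simp add: coef_var_sum coef_sum sum.swap[of _ A])

lemma var_sum_mult: "var_sum W (\<lambda>j. q j * f) = var_sum W q * f"
proof (rule mps_eqI)
  fix m
  have "coef (var_sum W (\<lambda>j. q j * f)) m =
      (\<Sum>(j, p)\<in>Sigma (vars m \<inter> W) (\<lambda>j. antidiag (m - var_mon j)). coef (q j) (fst p) * coef f (snd p))"
    by (subst sum.Sigma[symmetric]) (auto simp: coef_var_sum coef_mult case_prod_unfold)
  also have "\<dots> = (\<Sum>(p, j)\<in>Sigma (antidiag m) (\<lambda>p. vars (fst p) \<inter> W).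
      coef (q j) (fst p - var_mon j) * coef f (snd p))"
  proof (rule sum.reindex_bij_witness[where
        i = "\<lambda>(p, j). (j, (fst p - var_mon j, snd p))" and
        j = "\<lambda>(j, p). ((fst p + var_mon j, snd p), j)"], goal_cases)
    case (4 a)
    then obtain j x z where a: "a = ((x, z), j)" "x + z = m" "j \<in> vars x" "j \<in> W" by auto
    have "x - var_mon j + z = m - var_mon j"
      by (rule mon_eqI) (use a in \<open>auto simp: expo_var_mon in_vars_iff\<close>)
    then show ?case using a by auto
  next
    case (3 b)
    then show ?case using var_mon_minus by (fastforce simp: add.commute)
  next
    case (2 a)
    then obtain j x z where a: "a = (j, (x, z))" "x + z = m - var_mon j" "j \<in> vars m" "j \<in> W" by auto
    have "x + var_mon j + z = m" using var_mon_minus[OF a(3)] a(2) by (metis add.assoc add.commute)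
    then show ?case using a by auto
  qed auto
  also have "\<dots> = coef (var_sum W q * f) m"
    by (subst sum.Sigma[symmetric]) (auto simp: coef_var_sum coef_mult case_prod_unfold sum_distrib_right)
  finally show "coef (var_sum W (\<lambda>j. q j * f)) m = coef (var_sum W q * f) m" .
qed

text \<open>
  The quotients may contain all variables outside \<open>V\<close>, so multiplying by such variables keeps their form.
\<close>

lemma (in monic_family) var_sum_combs:
  assumes W: "W \<inter> V = {}" and q: "\<And>j. q j \<in> combs d"
  shows "var_sum W q \<in> combs (Suc d)"
proof -
  have "\<forall>j. \<exists>h. quotients d h \<and> q j = (\<Sum>b\<in>B. h b * \<gamma> b)" using q by (auto simp: combs_def)
  then obtain h where h: "\<And>j. quotients d (h j)" "\<And>j. q j = (\<Sum>b\<in>B. h j b * \<gamma> b)" by metis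
  have "var_sum W q = (\<Sum>b\<in>B. var_sum W (\<lambda>j. h j b) * \<gamma> b)"
    unfolding h(2) by (simp add: var_sum_sum var_sum_mult)
  moreover have "quotients (Suc d) (\<lambda>b. var_sum W (\<lambda>j. h j b))"
    unfolding quotients_def
  proof (intro ballI)
    fix b u assume b: "b \<in> B" and "u \<in> supp (var_sum W (\<lambda>j. h j b))"
    then obtain j u' where "j \<in> W" "u = var_mon j + u'" "u' \<in> supp (h j b)"
      using subsetD[OF supp_var_sum] by blast
    then show "vars u \<inter> V = {} \<and> tdeg u + tdeg b = Suc d"
      using h(1)[of j] b W by (auto simp: quotients_def tdeg_add)
  qed
  ultimately show ?thesis using combsI by simp
qed


section \<open>Initial ideals of locally finitely generated ideals\<close>

lemma in_bounded_ring: "f \<in> carrier bounded_ring \<longleftrightarrow> (\<exists>d. \<forall>m\<in>supp f. tdeg m \<le> d)"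
  by (simp add: bounded_ring_def mps_ring_def)

lemma bounded_ring_simps [simp]:
  "monoid.mult bounded_ring = (*)" "add bounded_ring = (+)" "ring.zero bounded_ring = 0" "one bounded_ring = 1"
  by (simp_all add: bounded_ring_def mps_ring_def)

lemma homogeneous_bounded: "homogeneous tdeg d f \<Longrightarrow> f \<in> carrier bounded_ring"
  unfolding in_bounded_ring homogeneous_def by (intro exI[of _ d]) simp

lemma monomial_bounded: "monomial m c \<in> carrier bounded_ring"
  by (rule homogeneous_bounded[of "tdeg m"]) (simp add: homogeneous_def supp_monomial)

lemma bounded_ring_ideal_iff:
  "ideal I bounded_ring \<longleftrightarrow> I \<subseteq> carrier bounded_ring \<and> 0 \<in> I \<and> (\<forall>f\<in>I. \<forall>g\<in>I. f + g \<in> I) \<and>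
     (\<forall>r\<in>carrier bounded_ring. \<forall>f\<in>I. r * f \<in> I)"
  (is "?L \<longleftrightarrow> ?R") for I :: "('v, 'a::comm_ring_1) mps set"
proof
  interpret R: cring "bounded_ring :: ('v, 'a) mps ring" by (rule cring_bounded_ring)
  {
    assume ?L
    then interpret ideal I bounded_ring .
    show ?R using a_subset zero_closed a_closed I_l_closed by auto
  next
    assume R: ?R
    show ?L
    proof (rule idealI[OF R.ring_axioms])
      show "subgroup I (add_monoid bounded_ring)"
      proof (rule R.add.subgroupI)
        fix f assume f: "f \<in> I"
        have "monomial 0 (- 1) * f \<in> I" using R f monomial_bounded by blast
        moreover have "monomial 0 (- 1) * f = - f" by (rule mps_eqI) simp
        moreover have "\<ominus>\<^bsub>bounded_ring\<^esub> f = - f"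
        proof (rule R.minus_equality)
          show "f \<in> carrier bounded_ring" "- f \<in> carrier bounded_ring"
            using R f by (auto simp: in_bounded_ring supp_uminus)
        qed simp
        ultimately show "\<ominus>\<^bsub>bounded_ring\<^esub> f \<in> I" by simp
      qed (use R in auto)
    next
      fix f r :: "('v, 'a) mps" assume "f \<in> I" "r \<in> carrier bounded_ring"
      then show "r \<otimes>\<^bsub>bounded_ring\<^esub> f \<in> I" "f \<otimes>\<^bsub>bounded_ring\<^esub> r \<in> I"
        using R by (simp_all add: mult.commute[of f])
    qed
  }
qed

text \<open>
  The finite combinations of \<open>S\<close> form an ideal that contains \<open>S\<close>.
\<close>

lemma genideal_bounded_ring:
  fixes S :: "('v, 'a::comm_ring_1) mps set"
  assumes S: "S \<subseteq> carrier bounded_ring" and f: "f \<in> Idl\<^bsub>bounded_ring\<^esub> S"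
  shows "\<exists>F r. finite F \<and> F \<subseteq> S \<and> r ` F \<subseteq> carrier bounded_ring \<and> f = (\<Sum>s\<in>F. r s * s)"
proof -
  interpret R: cring "bounded_ring :: ('v, 'a) mps ring" by (rule cring_bounded_ring)
  have add: "a + b \<in> carrier bounded_ring" and mult: "a * b \<in> carrier bounded_ring"
    if "a \<in> carrier bounded_ring" "b \<in> carrier bounded_ring" for a b :: "('v, 'a) mps"
    using R.a_closed[OF that] R.m_closed[OF that] by simp_all
  have zero: "(0 :: ('v, 'a) mps) \<in> carrier bounded_ring"
    using R.zero_closed by simp
  \<comment> \<open>Coefficients are total functions vanishing off a finite set, so that combinations can be added.\<close>
  define comb where "comb f F r \<longleftrightarrow> finite F \<and> F \<subseteq> S \<and> range r \<subseteq> carrier bounded_ring \<and>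
    (\<forall>s. s \<notin> F \<longrightarrow> r s = 0) \<and> f = (\<Sum>s\<in>F. r s * s)" for f F r
  define J where "J = {f. \<exists>F r. comb f F r}"
  have JI: "(\<Sum>s\<in>F. r s * s) \<in> J"
    if "finite F" "F \<subseteq> S" "range r \<subseteq> carrier bounded_ring" "\<And>s. s \<notin> F \<Longrightarrow> r s = 0" for F r
  proof -
    have "comb (\<Sum>s\<in>F. r s * s) F r" using that by (simp add: comb_def)
    then show ?thesis unfolding J_def by blast
  qed
  have JE: thesis
    if "f \<in> J" and "\<And>F r. finite F \<Longrightarrow> F \<subseteq> S \<Longrightarrow> range r \<subseteq> carrier bounded_ring \<Longrightarrow>
      \<forall>s. s \<notin> F \<longrightarrow> r s = 0 \<Longrightarrow> f = (\<Sum>s\<in>F. r s * s) \<Longrightarrow> thesis" for f thesis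
  proof -
    from that(1) obtain F r where "comb f F r" unfolding J_def by blast
    then show thesis unfolding comb_def by (elim conjE) (rule that(2))
  qed
  have "ideal J bounded_ring"
    unfolding bounded_ring_ideal_iff
  proof (intro conjI ballI subsetI)
    fix f assume "f \<in> J"
    then obtain F r where *: "finite F" "F \<subseteq> S" "range r \<subseteq> carrier bounded_ring" "f = (\<Sum>s\<in>F. r s * s)"
      by (rule JE)
    from *(1,2) have "(\<Sum>s\<in>F. r s * s) \<in> carrier bounded_ring"
    proof (induction F rule: finite_induct)
      case (insert s F)
      then have "r s * s + (\<Sum>s\<in>F. r s * s) \<in> carrier bounded_ring"
        using S *(3) by (intro add mult) auto
      with insert(1,2) show ?case by simp
    qed (simp add: zero)
    with *(4) show "f \<in> carrier bounded_ring" by simp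
  next
    show "0 \<in> J" using JI[of "{}" "\<lambda>_. 0"] zero by auto
  next
    fix f g assume fJ: "f \<in> J" and gJ: "g \<in> J"
    obtain F r where
      f: "finite F" "F \<subseteq> S" "range r \<subseteq> carrier bounded_ring" "\<forall>s. s \<notin> F \<longrightarrow> r s = 0" "f = (\<Sum>s\<in>F. r s * s)"
      using fJ by (rule JE)
    obtain G q where
      g: "finite G" "G \<subseteq> S" "range q \<subseteq> carrier bounded_ring" "\<forall>s. s \<notin> G \<longrightarrow> q s = 0" "g = (\<Sum>s\<in>G. q s * s)"
      using gJ by (rule JE)
    have "f = (\<Sum>s\<in>F \<union> G. r s * s)" "g = (\<Sum>s\<in>F \<union> G. q s * s)"
      unfolding f(5) g(5) using f(1,4) g(1,4) by (auto intro!: sum.mono_neutral_left)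
    then have "f + g = (\<Sum>s\<in>F \<union> G. (r s + q s) * s)" by (simp add: distrib_right sum.distrib)
    also have "\<dots> \<in> J"
    proof (rule JI)
      show "range (\<lambda>s. r s + q s) \<subseteq> carrier bounded_ring"
        using f(3) g(3) by (intro image_subsetI add) auto
    qed (use f g in auto)
    finally show "f + g \<in> J" .
  next
    fix p f assume p: "p \<in> carrier (bounded_ring :: ('v, 'a) mps ring)" and fJ: "f \<in> J"
    obtain F r where
      f: "finite F" "F \<subseteq> S" "range r \<subseteq> carrier bounded_ring" "\<forall>s. s \<notin> F \<longrightarrow> r s = 0" "f = (\<Sum>s\<in>F. r s * s)"
      using fJ by (rule JE)
    have "p * f = (\<Sum>s\<in>F. (p * r s) * s)" by (simp add: f(5) sum_distrib_left mult.assoc)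
    also have "\<dots> \<in> J"
    proof (rule JI)
      show "range (\<lambda>s. p * r s) \<subseteq> carrier bounded_ring"
        using f(3) p by (intro image_subsetI mult) auto
    qed (use f in auto)
    finally show "p * f \<in> J" .
  qed
  moreover have "S \<subseteq> J"
  proof
    fix s assume "s \<in> S"
    then show "s \<in> J"
      using JI[of "{s}" "\<lambda>x. if x = s then 1 else 0"] zero R.one_closed by auto
  qed
  ultimately have "f \<in> J" using R.genideal_minimal f by blast
  then obtain F r where "finite F" "F \<subseteq> S" "range r \<subseteq> carrier bounded_ring" "f = (\<Sum>s\<in>F. r s * s)"
    by (rule JE)
  then show ?thesis by (intro exI[of _ F] exI[of _ r]) auto
qed

locale lfg_ideal = term_ordered gt for gt +
  fixes I :: "(nat, 'k::field) mps set"
  assumes ideal_I: "ideal I bounded_ring"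
    and lfg: "locally_fin_gen I"
begin

lemmas ideal_I_facts = ideal_I[unfolded bounded_ring_ideal_iff]

lemma I_0: "0 \<in> I"
  and I_add: "f \<in> I \<Longrightarrow> g \<in> I \<Longrightarrow> f + g \<in> I"
  and I_mult: "r \<in> carrier bounded_ring \<Longrightarrow> f \<in> I \<Longrightarrow> r * f \<in> I"
  using ideal_I_facts by blast+

lemma linear_set_I: "linear_set I"
  unfolding linear_set_def by (intro conjI ballI allI I_0 I_add I_mult monomial_bounded)

lemma component_I: "f \<in> I \<Longrightarrow> component tdeg d f \<in> I"
  using conjunct1[OF lfg[unfolded locally_fin_gen_def]] by (simp add: homogeneous_ideal_def)

text \<open>
  These are the monomials of the initial ideal (\<open>monomial_in_initial_ideal_iff\<close>), and every one of them
  is itself the leading monomial of an element of \<open>I\<close>.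
\<close>

definition lead_mons :: "nat mon set" where
  "lead_mons = leads gt {f \<in> I. \<exists>d. homogeneous tdeg d f}"

lemma lead_monsE:
  assumes "m \<in> lead_mons"
  obtains f where "f \<in> I" "homogeneous tdeg (tdeg m) f" "is_lead gt f m" "coef f m = 1"
proof -
  obtain f d where f: "f \<in> I" "homogeneous tdeg d f" "is_lead gt f m"
    using assms unfolding lead_mons_def leads_def by blast
  have m: "m \<in> supp f" using f(3) by (simp add: is_lead_def)
  then have d: "d = tdeg m" using f(2) by (auto simp: homogeneous_def)
  let ?c = "inverse (coef f m)"
  have c: "?c \<noteq> 0" using m by (simp add: supp_def)
  have supp: "supp (monomial 0 ?c * f) = supp f" using c by (auto simp: supp_def)
  show thesis
  proof (rule that[of "monomial 0 ?c * f"])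
    show "monomial 0 ?c * f \<in> I" using f(1) by (rule I_mult[OF monomial_bounded])
    show "homogeneous tdeg (tdeg m) (monomial 0 ?c * f)" using f(2) d by (simp add: homogeneous_def supp)
    show "is_lead gt (monomial 0 ?c * f) m" using f(3) by (simp add: is_lead_def supp)
    show "coef (monomial 0 ?c * f) m = 1" using c by simp
  qed
qed

lemma lead_monsI: "f \<in> I \<Longrightarrow> homogeneous tdeg d f \<Longrightarrow> is_lead gt f m \<Longrightarrow> m \<in> lead_mons"
  unfolding lead_mons_def leads_def by blast

lemma lead_mons_add: assumes "m \<in> lead_mons" shows "m + u \<in> lead_mons"
proof -
  obtain f where f: "f \<in> I" "homogeneous tdeg (tdeg m) f" "is_lead gt f m" using lead_monsE[OF assms] by blast
  have "homogeneous tdeg (tdeg u + tdeg m) (monomial u 1 * f)"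
    by (intro homogeneous_mult f) (simp add: homogeneous_def supp_monomial)
  then have "u + m \<in> lead_mons"
    by (rule lead_monsI[OF I_mult[OF monomial_bounded f(1)] _ is_lead_monomial_mult[OF f(3)]])
  then show ?thesis by (simp add: add.commute)
qed

text \<open>
  The set of leading monomials is closed under multiplication by monomials, so the series supported
  on it form an ideal; hence generating an ideal adds no further monomials.
\<close>

lemma monomial_in_initial_ideal_iff: "monomial m 1 \<in> initial_ideal gt I \<longleftrightarrow> m \<in> lead_mons"
proof -
  interpret R: cring "bounded_ring :: (nat, 'k) mps ring" by (rule cring_bounded_ring)
  let ?S = "{monomial (initial gt f) 1 | f. f \<in> I \<and> f \<noteq> 0 \<and> (\<exists>d. homogeneous tdeg d f)} :: (nat, 'k) mps set"
  have S: "?S = (\<lambda>m. monomial m 1) ` lead_mons"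
  proof (intro equalityI subsetI)
    fix x assume "x \<in> ?S"
    then obtain f d where f: "x = monomial (initial gt f) 1" "f \<in> I" "f \<noteq> 0" "homogeneous tdeg d f" by blast
    then obtain m where m: "is_lead gt f m" using ex_lead by blast
    with f have "x = monomial m 1" "m \<in> lead_mons" using initial_eq lead_monsI by auto
    then show "x \<in> (\<lambda>m. monomial m 1) ` lead_mons" by blast
  next
    fix x assume "x \<in> (\<lambda>m. monomial m (1 :: 'k)) ` lead_mons"
    then obtain m where m: "x = monomial m 1" "m \<in> lead_mons" by blast
    obtain f where f: "f \<in> I" "homogeneous tdeg (tdeg m) f" "is_lead gt f m" using lead_monsE[OF m(2)] by blast
    moreover have "f \<noteq> 0" using f(3) by (auto simp: is_lead_def supp_0_1)
    ultimately show "x \<in> ?S" using initial_eq[OF f(3)] m(1) by blast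
  qed
  have Sc: "?S \<subseteq> carrier bounded_ring" unfolding S using monomial_bounded by blast
  show ?thesis
  proof
    assume "m \<in> lead_mons"
    then show "monomial m 1 \<in> initial_ideal gt I"
      unfolding initial_ideal_def using R.genideal_self[OF Sc] S by blast
  next
    let ?K = "{f \<in> carrier bounded_ring. supp f \<subseteq> lead_mons} :: (nat, 'k) mps set"
    have "ideal ?K bounded_ring"
      unfolding bounded_ring_ideal_iff
    proof (intro conjI ballI)
      show "0 \<in> ?K" using R.zero_closed by (simp add: supp_0_1)
    next
      fix f g assume "f \<in> ?K" "g \<in> ?K"
      then show "f + g \<in> ?K" using R.a_closed[of f g] supp_add[of f g] by auto
    next
      fix r f assume r: "r \<in> carrier (bounded_ring :: (nat, 'k) mps ring)" and f: "f \<in> ?K"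
      have "supp (r * f) \<subseteq> lead_mons"
      proof
        fix m assume "m \<in> supp (r * f)"
        then obtain u w where "m = u + w" "w \<in> supp f" by (rule supp_multE)
        then show "m \<in> lead_mons" using f lead_mons_add[of w u] by (auto simp: add.commute)
      qed
      then show "r * f \<in> ?K" using R.m_closed[of r f] r f by simp
    qed auto
    moreover have "?S \<subseteq> ?K" unfolding S using monomial_bounded by (auto simp: supp_monomial)
    ultimately have "initial_ideal gt I \<subseteq> ?K"
      unfolding initial_ideal_def by (rule R.genideal_minimal)
    moreover assume "monomial m 1 \<in> initial_ideal gt I"
    ultimately show "m \<in> lead_mons" by (auto simp: supp_monomial)
  qed
qed

text \<open>
  Equivalently, up to degree \<open>d\<close> the set of leading monomials is generated by its members in the
  variables \<open>V\<close>.
\<close>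

definition stable_upto :: "nat set \<Rightarrow> nat \<Rightarrow> bool" where
  "stable_upto V d \<longleftrightarrow> (\<forall>m\<in>lead_mons. tdeg m \<le> d \<longrightarrow> part V m \<in> lead_mons)"

lemma part_lead_mons_mono:
  assumes "part V m \<in> lead_mons" "V \<subseteq> V'" shows "part V' m \<in> lead_mons"
proof -
  have "part V' m = part V m + part (V' - V) m" by (rule mon_eqI) (use assms(2) in auto)
  then show ?thesis using lead_mons_add[OF assms(1)] by simp
qed

lemma stable_upto_mono: "stable_upto V d \<Longrightarrow> V \<subseteq> V' \<Longrightarrow> d' \<le> d \<Longrightarrow> stable_upto V' d'"
  unfolding stable_upto_def using part_lead_mons_mono by (meson order_trans)

definition gen :: "nat mon \<Rightarrow> (nat, 'k) mps" where
  "gen b = (SOME f. f \<in> I \<and> homogeneous tdeg (tdeg b) f \<and> is_lead gt f b \<and> coef f b = 1)"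

lemma gen:
  assumes "b \<in> lead_mons"
  shows "gen b \<in> I" "homogeneous tdeg (tdeg b) (gen b)" "is_lead gt (gen b) b" "coef (gen b) b = 1"
proof -
  have "\<exists>f. f \<in> I \<and> homogeneous tdeg (tdeg b) f \<and> is_lead gt f b \<and> coef f b = 1"
    using lead_monsE[OF assms] by metis
  from someI_ex[OF this]
  show "gen b \<in> I" "homogeneous tdeg (tdeg b) (gen b)" "is_lead gt (gen b) b" "coef (gen b) b = 1"
    by (simp_all add: gen_def)
qed

definition basis_mons :: "nat set \<Rightarrow> nat \<Rightarrow> nat mon set" where
  "basis_mons V d = {b \<in> lead_mons. vars b \<subseteq> V \<and> tdeg b \<le> d}"

lemma monic_family_gen: "finite V \<Longrightarrow> monic_family gt V (basis_mons V d) gen"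
proof (unfold_locales, goal_cases)
  case 1
  show ?case unfolding basis_mons_def
    by (rule finite_subset[OF _ finite_mons_tdeg_le[OF 1, of d]]) auto
qed (auto simp: basis_mons_def gen)

text \<open>
  The remainder of the division lies in \<open>I\<close>. If it were nonzero, its leading monomial would have its part
  in \<open>V\<close> among the basis monomials by stability, and the division leaves no such monomial.
\<close>

lemma in_combs:
  assumes V: "finite V" "stable_upto V d" and f: "f \<in> I" "homogeneous tdeg e f" "e \<le> d"
  shows "f \<in> monic_family.combs V (basis_mons V d) gen e"
proof -
  interpret M: monic_family gt V "basis_mons V d" gen by (rule monic_family_gen[OF V(1)])
  obtain q where q: "q \<in> M.combs e" "\<forall>m\<in>supp (f - q). part V m \<notin> basis_mons V d"
    using M.division[OF f(2)] by blast
  have "q \<in> I"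
  proof -
    obtain h where h: "M.quotients e h" "q = (\<Sum>b\<in>basis_mons V d. h b * gen b)"
      using q(1) by (auto simp: M.combs_def)
    have "h b * gen b \<in> I" if "b \<in> basis_mons V d" for b
    proof (rule I_mult)
      show "h b \<in> carrier bounded_ring"
        unfolding in_bounded_ring using h(1) that by (intro exI[of _ e]) (fastforce simp: M.quotients_def)
      show "gen b \<in> I" using that gen(1) by (simp add: basis_mons_def)
    qed
    then show ?thesis unfolding h(2) by (intro linear_set_sum[OF linear_set_I])
  qed
  have "f - q = 0"
  proof (rule ccontr)
    assume "f - q \<noteq> 0"
    have hom: "homogeneous tdeg e (f - q)" using f(2) M.homogeneous_combs[OF q(1)] by (rule homogeneous_diff)
    then obtain m where m: "is_lead gt (f - q) m" using ex_lead \<open>f - q \<noteq> 0\<close> by blast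
    then have supp: "m \<in> supp (f - q)" by (simp add: is_lead_def)
    have "m \<in> lead_mons" using linear_set_diff[OF linear_set_I f(1) \<open>q \<in> I\<close>] hom m by (rule lead_monsI)
    moreover have "tdeg m \<le> d" using hom supp f(3) by (simp add: homogeneous_def)
    ultimately have "part V m \<in> basis_mons V d"
      using V(2) tdeg_part_le[of V m] by (auto simp: stable_upto_def basis_mons_def)
    with q(2) supp show False by blast
  qed
  with q(1) show ?thesis by simp
qed

text \<open>
  Up to a space \<open>E\<close> of finite dimension, every element of degree \<open>d + 1\<close> is a combination of the same family
  that works in degree \<open>d\<close>: a monomial with a variable outside \<open>V\<close> in the cofactor of a generator can
  give up that variable, which reduces to degree \<open>d\<close>, and putting it back affects only the quotients.
\<close>

lemma stable_upto_Suc: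
  assumes V: "finite V" "stable_upto V d"
  shows "\<exists>V'. finite V' \<and> stable_upto V' (Suc d)"
proof -
  interpret M: monic_family gt V "basis_mons V d" gen by (rule monic_family_gen[OF V(1)])
  obtain S where S: "S \<subseteq> carrier bounded_ring" "I = Idl\<^bsub>bounded_ring\<^esub> S"
    "\<forall>f\<in>S. \<exists>d. homogeneous tdeg d f" "\<And>d. finite {f\<in>S. homogeneous tdeg d f}"
    using lfg unfolding locally_fin_gen_def by blast
  have S_I: "s \<in> I" if "s \<in> S" for s
    using ring.genideal_self[OF cring.axioms(1)[OF cring_bounded_ring] S(1)] S(2) that by blast
  let ?T = "M.combs (Suc d)"
  define E where "E = {monomial u 1 * s | u s. vars u \<subseteq> V \<and> tdeg u \<le> Suc d \<and>
    s \<in> (\<Union>e\<le>Suc d. {f\<in>S. homogeneous tdeg e f})}"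
  have "finite E"
  proof -
    have "finite ((\<lambda>(u, s). monomial u 1 * s) `
      ({u. vars u \<subseteq> V \<and> tdeg u \<le> Suc d} \<times> (\<Union>e\<le>Suc d. {f\<in>S. homogeneous tdeg e f})))"
      using finite_mons_tdeg_le[OF V(1)] S(4) by (intro finite_imageI finite_cartesian_product) auto
    then show ?thesis by (rule finite_subset[rotated]) (auto simp: E_def)
  qed
  have lin: "linear_set (span_over ?T E)" by (rule linear_set_span_over[OF M.linear_set_combs])
  have product: "component tdeg (Suc d) (r * s) \<in> span_over ?T E" if s: "s \<in> S" for r s
  proof -
    obtain e where e: "homogeneous tdeg e s" using S(3) s by blast
    show ?thesis
    proof (cases "e \<le> Suc d")
      case True
      define c where "c = component tdeg (Suc d - e) r"
      define low where "low = MPS (\<lambda>u. if vars u \<subseteq> V then coef c u else 0)"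
      \<comment> \<open>Every monomial of \<open>c\<close> with a variable outside \<open>V\<close> gives up the least such variable, \<open>j\<close>.\<close>
      define p where "p = (\<lambda>j. MPS (\<lambda>u. if j = (LEAST i. i \<in> vars (u + var_mon j) - V) then coef c (u + var_mon j) else 0))"
      have c_eq: "c = low + var_sum (- V) p"
      proof (rule mps_eqI)
        fix m
        let ?j = "LEAST i. i \<in> vars m - V"
        have "coef (var_sum (- V) p) m = (\<Sum>j\<in>vars m \<inter> - V. if j = ?j then coef c m else 0)"
          unfolding coef_var_sum p_def coef_MPS
        proof (intro sum.cong refl)
          fix j assume "j \<in> vars m \<inter> - V"
          then have "m - var_mon j + var_mon j = m" using var_mon_minus[of j m] by (simp add: add.commute)
          then show "(if j = (LEAST i. i \<in> vars (m - var_mon j + var_mon j) - V)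
              then coef c (m - var_mon j + var_mon j) else 0) = (if j = ?j then coef c m else 0)"
            by (simp only:)
        qed
        also have "\<dots> = (if vars m \<subseteq> V then 0 else coef c m)"
        proof (cases "vars m \<subseteq> V")
          case False
          then have "?j \<in> vars m - V" by (metis (no_types, lifting) DiffI LeastI subsetI)
          with False show ?thesis by simp
        qed (auto intro: sum.neutral)
        finally show "coef c m = coef (low + var_sum (- V) p) m" by (simp add: low_def)
      qed
      have "low * s \<in> span_over ?T E"
      proof -
        let ?U = "{u. vars u \<subseteq> V \<and> tdeg u \<le> Suc d}"
        have fin: "finite ?U" by (rule finite_mons_tdeg_le[OF V(1)])
        have "low = (\<Sum>u\<in>?U. monomial 0 (coef c u) * monomial u 1)"
        proof (rule mps_eqI)
          fix m
          show "coef low m = coef (\<Sum>u\<in>?U. monomial 0 (coef c u) * monomial u 1) m"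
            using fin by (auto simp: coef_sum coef_monomial low_def c_def if_distrib[of "(*) _"] cong: if_cong)
        qed
        then have "low * s = (\<Sum>u\<in>?U. monomial 0 (coef c u) * (monomial u 1 * s))"
          by (simp only: sum_distrib_right mult.assoc)
        also have "\<dots> \<in> span_over ?T E"
        proof (rule linear_set_sum[OF lin])
          fix u assume "u \<in> ?U"
          then have "monomial u 1 * s \<in> E" unfolding E_def using s e True by blast
          then show "monomial 0 (coef c u) * (monomial u 1 * s) \<in> span_over ?T E"
            using linear_setD(3)[OF lin] span_over_generator[OF M.linear_set_combs \<open>finite E\<close>] by blast
        qed
        finally show ?thesis .
      qed
      moreover have "var_sum (- V) p * s \<in> span_over ?T E"
      proof -
        have "p j * s \<in> M.combs d" for j
        proof (rule in_combs[OF V])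
          have deg: "tdeg u + 1 + e = Suc d" if "u \<in> supp (p j)" for u
          proof -
            have "u + var_mon j \<in> supp c" using that by (auto simp: p_def supp_def split: if_splits)
            then have "tdeg (u + var_mon j) = Suc d - e" by (auto simp: c_def supp_def split: if_splits)
            with True show ?thesis by (simp add: tdeg_add)
          qed
          then have "\<forall>u\<in>supp (p j). tdeg u \<le> d" by fastforce
          then show "p j * s \<in> I" using S_I[OF s] by (intro I_mult) (auto simp: in_bounded_ring)
          show "homogeneous tdeg d (p j * s)"
            unfolding homogeneous_def
          proof
            fix m assume "m \<in> supp (p j * s)"
            then obtain u w where "m = u + w" "u \<in> supp (p j)" "w \<in> supp s" by (rule supp_multE)
            then show "tdeg m = d" using deg[of u] e by (simp add: homogeneous_def tdeg_add)
          qed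
        qed simp
        then have "var_sum (- V) (\<lambda>j. p j * s) \<in> ?T" by (intro M.var_sum_combs) auto
        then show ?thesis unfolding var_sum_mult by (rule span_over_superset)
      qed
      ultimately have "c * s \<in> span_over ?T E"
        unfolding c_eq distrib_right by (rule linear_setD(2)[OF lin])
      then show ?thesis using True by (simp add: component_mult_homogeneous[OF e] c_def)
    qed (simp add: component_mult_homogeneous[OF e] linear_setD(1)[OF lin])
  qed
  have I_span: "f \<in> span_over ?T E" if f: "f \<in> I" "homogeneous tdeg (Suc d) f" for f
  proof -
    obtain F r where F: "F \<subseteq> S" "f = (\<Sum>s\<in>F. r s * s)"
      using genideal_bounded_ring[OF S(1)] f(1) S(2) by blast
    have "f = (\<Sum>s\<in>F. component tdeg (Suc d) (r s * s))"
      using component_id[OF f(2)] unfolding F(2) component_sum by simp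
    also have "\<dots> \<in> span_over ?T E"
      using F(1) product by (intro linear_set_sum[OF lin]) blast
    finally show ?thesis .
  qed
  \<comment> \<open>The leading monomials of degree \<open>d + 1\<close> that are not controlled by \<open>V\<close>.\<close>
  define L where "L = leads gt (span_over ?T E) - leads gt ?T"
  have "finite L" unfolding L_def by (rule finite_new_leads[OF M.linear_set_combs \<open>finite E\<close>])
  define V' where "V' = V \<union> (\<Union>m\<in>L. vars m)"
  have "part V' m \<in> lead_mons" if m: "m \<in> lead_mons" "tdeg m \<le> Suc d" for m
  proof (cases "tdeg m \<le> d")
    case True
    then have "part V m \<in> lead_mons" using V(2) m(1) by (simp add: stable_upto_def)
    then show ?thesis by (rule part_lead_mons_mono) (simp add: V'_def)
  next
    case False
    then have d: "tdeg m = Suc d" using m(2) by simp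
    obtain f where "f \<in> I" "homogeneous tdeg (tdeg m) f" "is_lead gt f m" using lead_monsE[OF m(1)] by blast
    then have "m \<in> leads gt (span_over ?T E)" using I_span d by (auto simp: leads_def)
    then consider "m \<in> L" | "m \<in> leads gt ?T" unfolding L_def by blast
    then show ?thesis
    proof cases
      case 1
      then have "part V' m = m" by (intro part_id) (auto simp: V'_def)
      with m(1) show ?thesis by simp
    next
      case 2
      then have "part V m \<in> lead_mons" using M.leads_combs by (auto simp: basis_mons_def)
      then show ?thesis by (rule part_lead_mons_mono) (simp add: V'_def)
    qed
  qed
  then have "stable_upto V' (Suc d)" by (simp add: stable_upto_def)
  moreover have "finite V'" using V(1) \<open>finite L\<close> by (simp add: V'_def)
  ultimately show ?thesis by blast
qed

theorem ex_stable_upto: "\<exists>N. stable_upto {..<N} d"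
proof -
  have "\<exists>V. finite V \<and> stable_upto V d"
  proof (induction d)
    case 0
    have "stable_upto {} 0" unfolding stable_upto_def by (auto simp: part_id)
    then show ?case by blast
  next
    case (Suc d)
    then show ?case using stable_upto_Suc by blast
  qed
  then obtain V where V: "finite V" "stable_upto V d" by blast
  obtain N where "V \<subseteq> {..<N}" using finite_nat_iff_bounded V(1) by blast
  with V(2) show ?thesis using stable_upto_mono by blast
qed

text \<open>
  The truncated family has the same leading monomials because these lie in the first \<open>n\<close> variables.
  Truncating an expression of \<open>f\<close> by the family thus gives an expression of the truncation by the
  truncated family, whose leading monomial is controlled by \<open>leads_combs\<close>.
\<close>

lemma leads_trunc:
  assumes n: "stable_upto {..<n} d" and f: "f \<in> I" "homogeneous tdeg d (trunc n f)"
    and m: "is_lead gt (trunc n f) m"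
  shows "m \<in> lead_mons"
proof -
  let ?V = "{..<n}" and ?B = "basis_mons {..<n} d"
  interpret M: monic_family gt ?V ?B gen by (rule monic_family_gen) simp
  interpret Mt: monic_family gt ?V ?B "\<lambda>b. trunc n (gen b)"
  proof (unfold_locales, goal_cases)
    case (3 b)
    then show ?case using M.lead_\<gamma> M.vars_B is_lead_trunc by blast
  next
    case (5 b)
    then show ?case using M.homogeneous_\<gamma>[of b] by (auto simp: homogeneous_def supp_trunc)
  qed (use M.finite_B M.vars_B M.monic_\<gamma> in auto)
  let ?f = "component tdeg d f"
  have "?f \<in> M.combs d"
    by (rule in_combs[OF _ n component_I[OF f(1)]]) simp_all
  then obtain h where h: "M.quotients d h" "?f = (\<Sum>b\<in>?B. h b * gen b)" by (auto simp: M.combs_def)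
  have "trunc n f = trunc n ?f" by (simp add: trunc_component component_id[OF f(2)])
  also have "\<dots> = (\<Sum>b\<in>?B. trunc n (h b) * trunc n (gen b))"
    by (simp add: h(2) trunc_sum trunc_mult)
  also have "\<dots> \<in> Mt.combs d"
    using h(1) by (intro Mt.combsI) (auto simp: M.quotients_def Mt.quotients_def supp_trunc)
  finally have "part ?V m \<in> ?B" using m by (intro Mt.leads_combs[of m d]) (auto simp: leads_def)
  then have "part ?V m + part (- ?V) m \<in> lead_mons" by (intro lead_mons_add) (simp add: basis_mons_def)
  then show ?thesis unfolding part_compl .
qed

end


section \<open>Hilbert functions count standard monomials\<close>

lemma mps_ring_simps [simp]:
  "carrier (mps_ring A) = A" "monoid.mult (mps_ring A) = (*)" "add (mps_ring A) = (+)"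
  "ring.zero (mps_ring A) = 0" "one (mps_ring A) = 1"
  by (simp_all add: mps_ring_def)

lemma polys_memI: "finite (supp f) \<Longrightarrow> (\<And>m. m \<in> supp f \<Longrightarrow> vars m \<subseteq> V) \<Longrightarrow> f \<in> polys V"
  by (simp add: polys_def)

lemma minus_polynomial_ring:
  fixes f :: "('v, 'a::comm_ring_1) mps"
  assumes "f \<in> polys V" shows "\<ominus>\<^bsub>polynomial_ring V\<^esub> f = - f"
proof -
  interpret R: cring "polynomial_ring V :: ('v, 'a) mps ring" by (rule cring_polynomial_ring)
  show ?thesis by (rule R.minus_equality) (use assms in \<open>auto simp: polys_def supp_uminus\<close>)
qed

lemma ideal_trunc:
  fixes I :: "(nat, 'a::comm_ring_1) mps set"
  assumes "ideal I bounded_ring"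
  shows "ideal (trunc n ` I) (polynomial_ring {..<n})"
proof -
  interpret R: cring "polynomial_ring {..<n} :: (nat, 'a) mps ring" by (rule cring_polynomial_ring)
  have I: "I \<subseteq> carrier bounded_ring" "0 \<in> I" "\<And>f g. f \<in> I \<Longrightarrow> g \<in> I \<Longrightarrow> f + g \<in> I"
    "\<And>r f. r \<in> carrier bounded_ring \<Longrightarrow> f \<in> I \<Longrightarrow> r * f \<in> I"
    using assms unfolding bounded_ring_ideal_iff by blast+
  have polys: "trunc n f \<in> polys {..<n}" if "f \<in> I" for f
  proof (rule polys_memI)
    obtain d where "\<forall>m\<in>supp f. tdeg m \<le> d" using I(1) \<open>f \<in> I\<close> in_bounded_ring by blast
    then show "finite (supp (trunc n f))"
      by (intro finite_subset[OF _ finite_mons_tdeg_le[of "{..<n}" d]]) (auto simp: supp_trunc)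
  qed (simp add: supp_trunc)
  have mult: "r * g \<in> trunc n ` I" if "r \<in> polys {..<n}" "g \<in> trunc n ` I" for r g
  proof -
    obtain f where f: "f \<in> I" "g = trunc n f" using \<open>g \<in> trunc n ` I\<close> by blast
    have "finite (supp r)" using \<open>r \<in> polys {..<n}\<close> by (simp add: polys_def)
    then have "r \<in> carrier bounded_ring"
      unfolding in_bounded_ring by (intro exI[of _ "Max (tdeg ` supp r)"]) auto
    then have "r * f \<in> I" using f(1) by (rule I(4))
    moreover have "trunc n (r * f) = r * g" using f(2) by (simp add: trunc_mult trunc_polys[OF that(1)])
    ultimately show ?thesis by (metis imageI)
  qed
  show ?thesis
  proof (rule idealI[OF R.ring_axioms])
    show "subgroup (trunc n ` I) (add_monoid (polynomial_ring {..<n}))"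
    proof (rule R.add.subgroupI)
      fix g assume g: "g \<in> trunc n ` I"
      have "monomial 0 (- 1) * g \<in> trunc n ` I" using g by (intro mult) (auto simp: polys_def supp_monomial)
      moreover have "monomial 0 (- 1) * g = - g" by (rule mps_eqI) simp
      ultimately show "\<ominus>\<^bsub>polynomial_ring {..<n}\<^esub> g \<in> trunc n ` I"
        using minus_polynomial_ring[of g "{..<n}"] polys g by auto
    next
      fix g h assume "g \<in> trunc n ` I" "h \<in> trunc n ` I"
      then obtain g' h' where "g' \<in> I" "h' \<in> I" "g = trunc n g'" "h = trunc n h'" by blast
      then show "g \<oplus>\<^bsub>polynomial_ring {..<n}\<^esub> h \<in> trunc n ` I"
        using I(3)[of g' h'] trunc_add[of n g' h'] by (metis imageI mps_ring_simps(3))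
    qed (use I(2) polys in auto)
  next
    fix g r :: "(nat, 'a) mps"
    assume "g \<in> trunc n ` I" "r \<in> carrier (polynomial_ring {..<n})"
    then show "r \<otimes>\<^bsub>polynomial_ring {..<n}\<^esub> g \<in> trunc n ` I" "g \<otimes>\<^bsub>polynomial_ring {..<n}\<^esub> r \<in> trunc n ` I"
      using mult[of r g] by (simp_all add: mult.commute[of g])
  qed
qed

lemma subfield_constants:
  "subfield (range (monomial 0)) (polynomial_ring V :: ('v, 'k::field) mps ring)"
proof -
  let ?A = "polynomial_ring V :: ('v, 'k) mps ring"
  let ?K = "range (monomial 0) :: ('v, 'k) mps set"
  interpret R: cring ?A by (rule cring_polynomial_ring)
  have polys: "monomial 0 c \<in> polys V" for c :: 'k by (simp add: polys_def supp_monomial)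
  have neg: "- monomial 0 c = (monomial 0 (- c) :: ('v, 'k) mps)" for c
    by (rule mps_eqI) (simp add: coef_monomial)
  have "subring ?K ?A"
  proof (rule R.subringI)
    show "?K \<subseteq> carrier ?A" using polys by auto
    show "\<one>\<^bsub>?A\<^esub> \<in> ?K" by (metis monomial_0_1 mps_ring_simps(5) rangeI)
    show "\<ominus>\<^bsub>?A\<^esub> h \<in> ?K" if "h \<in> ?K" for h
      using that by (auto simp: minus_polynomial_ring[OF polys] neg)
    show "h1 \<otimes>\<^bsub>?A\<^esub> h2 \<in> ?K" if "h1 \<in> ?K" "h2 \<in> ?K" for h1 h2
      using that by (auto simp: monomial_mult)
    show "h1 \<oplus>\<^bsub>?A\<^esub> h2 \<in> ?K" if "h1 \<in> ?K" "h2 \<in> ?K" for h1 h2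
      using that by (auto simp: monomial_0_add[symmetric])
  qed
  then have "subcring ?K ?A" by (rule R.subcringI')
  moreover have "Units (?A \<lparr> carrier := ?K \<rparr>) = ?K - {\<zero>\<^bsub>?A\<^esub>}"
  proof (intro equalityI subsetI)
    fix x assume "x \<in> Units (?A \<lparr> carrier := ?K \<rparr>)"
    then obtain y where "x \<in> ?K" "x * y = 1" by (auto simp: Units_def)
    then show "x \<in> ?K - {\<zero>\<^bsub>?A\<^esub>}" by auto
  next
    fix x assume x: "x \<in> ?K - {\<zero>\<^bsub>?A\<^esub>}"
    then obtain c where c: "x = monomial 0 c" by auto
    with x have "c \<noteq> 0" by auto
    with c have "x * monomial 0 (inverse c) = 1" "monomial 0 (inverse c) * x = 1"
      by (simp_all add: monomial_mult)
    with x show "x \<in> Units (?A \<lparr> carrier := ?K \<rparr>)"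
      unfolding Units_def by (auto intro!: bexI[of _ "monomial 0 (inverse c)"])
  qed
  ultimately show ?thesis by (rule R.subfieldI)
qed

lemma dimension_trivial_ring:
  assumes "ring.dimension R n K E" and R: "ring R" and "carrier R = {\<zero>\<^bsub>R\<^esub>}"
  shows "n = 0 \<and> E = {\<zero>\<^bsub>R\<^esub>}"
proof -
  interpret ring R by (rule R)
  from assms(1) show ?thesis
    by (induction rule: dimension.induct) (use assms(3) in auto)
qed

text \<open>
  In the zero ring, which arises as a quotient by the unit ideal, no subset is a subfield; there
  dimensions are unique because every space is zero.
\<close>

lemma dim_eq:
  assumes R: "ring R" and K: "\<one>\<^bsub>R\<^esub> \<noteq> \<zero>\<^bsub>R\<^esub> \<Longrightarrow> subfield K R" and d: "ring.dimension R n K E"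
  shows "ring.dim R K E = n"
proof -
  interpret ring R by (rule R)
  have "k = n" if "dimension k K E" for k
  proof (cases "\<one>\<^bsub>R\<^esub> = \<zero>\<^bsub>R\<^esub>")
    case True
    then have "carrier R = {\<zero>\<^bsub>R\<^esub>}" by (rule one_zeroD)
    then show ?thesis using dimension_trivial_ring[OF that R] dimension_trivial_ring[OF d R] by simp
  next
    case False
    then show ?thesis using dimension_is_inj[OF K that d] by simp
  qed
  then show ?thesis unfolding dim_def by (intro the_equality d)
qed

context term_ordered begin

text \<open>
  Adjoin the monomials of degree \<open>\<alpha>\<close> one by one, from the smallest to the largest. The space spanned by
  their residue classes grows exactly when the new monomial is not the leading monomial of an
  element of \<open>P\<close>, since otherwise that element expresses it by smaller ones.
\<close>

theorem coef_hilbert_series: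
  fixes P :: "(nat, 'k::field) mps set"
  assumes V: "finite V" and P: "ideal P (polynomial_ring V)"
  shows "coef (hilbert_series y V P) \<alpha> =
    int (card {m. vars m \<subseteq> V \<and> mdeg y m = \<alpha> \<and> m \<notin> leads gt {f\<in>P. homogeneous (mdeg y) \<alpha> f}})"
proof -
  let ?A = "polynomial_ring V :: (nat, 'k) mps ring"
  let ?cls = "\<lambda>f. P +>\<^bsub>?A\<^esub> f"
  let ?Q = "?A Quot P"
  let ?K = "?cls ` range (monomial 0)"
  interpret A: cring ?A by (rule cring_polynomial_ring)
  interpret P: ideal P ?A by (rule P)
  interpret h: ring_hom_ring ?A ?Q ?cls by (rule P.rcos_ring_hom_ring)
  define M where "M = {m. vars m \<subseteq> V \<and> mdeg y m = \<alpha>}"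
  define L where "L = leads gt {f\<in>P. homogeneous (mdeg y) \<alpha> f}"
  have "finite M" unfolding M_def by (rule finite_mons_mdeg[OF V])
  have polysI: "f \<in> polys V" if "supp f \<subseteq> M" for f :: "(nat, 'k) mps"
    using that finite_subset[OF that \<open>finite M\<close>] by (auto simp: polys_def M_def)
  have P_polys: "f \<in> polys V" if "f \<in> P" for f using P.a_subset that by auto
  have P_add: "f + g \<in> P" if "f \<in> P" "g \<in> P" for f g using P.a_closed[OF that] by simp
  have P_mult: "r * f \<in> P" if "r \<in> polys V" "f \<in> P" for r f using P.I_l_closed[OF that(2)] that(1) by simp
  have const: "monomial 0 c \<in> polys V" for c :: 'k by (simp add: polys_def supp_monomial)
  have cls: "?cls f = {p + f | p. p \<in> P}" for f by (auto simp: a_r_coset_def')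
  have P_neg: "- p \<in> P" if "p \<in> P" for p
  proof -
    have "- p = monomial 0 (- 1) * p" by (rule mps_eqI) simp
    then show ?thesis using P_mult[OF const that] by simp
  qed
  have clsI: "p + f \<in> ?cls f" if "p \<in> P" for p f
    unfolding cls using that by (intro CollectI exI[of _ p]) simp
  have clsE: "\<exists>p\<in>P. x = p + f" if "x \<in> ?cls f" for x f
    using that unfolding cls by (elim CollectE exE conjE) (rule bexI)
  have cls_subset: "?cls f \<subseteq> ?cls g" if d: "f - g \<in> P" for f g
  proof
    fix x assume "x \<in> ?cls f"
    from clsE[OF this] obtain p where p: "p \<in> P" "x = p + f" by (elim bexE)
    have "x = (p + (f - g)) + g" using p(2) by simp
    then show "x \<in> ?cls g" using clsI[OF P_add[OF p(1) d], of g] by simp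
  qed
  have cls_eq: "?cls f = ?cls g \<longleftrightarrow> f - g \<in> P" for f g
  proof
    assume eq: "?cls f = ?cls g"
    have "0 + f \<in> ?cls f" using P.zero_closed by (intro clsI) simp
    then have "f \<in> ?cls g" using eq by simp
    from clsE[OF this] obtain p where "p \<in> P" "f = p + g" by (elim bexE)
    then show "f - g \<in> P" by simp
  next
    assume d: "f - g \<in> P"
    have "g - f \<in> P" using P_neg[OF d] by simp
    with d show "?cls f = ?cls g" by (intro equalityI cls_subset)
  qed
  have zero_Q: "\<zero>\<^bsub>?Q\<^esub> = ?cls 0" using h.hom_zero by (simp only: mps_ring_simps)
  have step: "h.S.dimension (card (D - L)) ?K (?cls ` {f. supp f \<subseteq> D})"
    if "D \<subseteq> M" "\<forall>m\<in>D. \<forall>m'\<in>M. gt m m' \<longrightarrow> m' \<in> D" for D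
    using that
  proof (induction "card D" arbitrary: D)
    case 0
    then have D: "D = {}" using finite_subset[OF _ \<open>finite M\<close>] by auto
    have "{f :: (nat, 'k) mps. supp f \<subseteq> {}} = {0}" using supp_empty_iff by auto
    then have "?cls ` {f. supp f \<subseteq> D} = {\<zero>\<^bsub>?Q\<^esub>}"
      unfolding D by (simp only: image_insert image_empty zero_Q)
    then show ?case using h.S.dimension.zero_dim[of ?K] by (simp only: D empty_Diff card.empty)
  next
    case (Suc k)
    then have "D \<noteq> {}" "finite D" using card_gt_0_iff[of D] by auto
    have "tdeg m = tdeg \<alpha>" if "m \<in> D" for m using that Suc(3) by (auto simp: M_def)
    then obtain m where m: "m \<in> D" "\<forall>m'\<in>D. m' \<noteq> m \<longrightarrow> gt m m'"
      using ex_max[OF \<open>D \<noteq> {}\<close>] by blast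
    have mM: "m \<in> M" using m(1) Suc(3) by blast
    define D' where "D' = D - {m}"
    have down: "\<forall>n\<in>D'. \<forall>m'\<in>M. gt n m' \<longrightarrow> m' \<in> D'"
    proof (intro ballI impI)
      fix n m' assume *: "n \<in> D'" "m' \<in> M" "gt n m'"
      then have "m' \<in> D" using Suc(4) by (auto simp: D'_def)
      moreover have "gt m n" using *(1) m(2) by (auto simp: D'_def)
      then have "m' \<noteq> m" using *(3) gt_asym by metis
      ultimately show "m' \<in> D'" by (simp add: D'_def)
    qed
    have IH: "h.S.dimension (card (D' - L)) ?K (?cls ` {f. supp f \<subseteq> D'})"
    proof (rule Suc(1)[OF _ _ down])
      show "k = card D'" using Suc(2) m(1) \<open>finite D\<close> by (simp add: D'_def)
      show "D' \<subseteq> M" using Suc(3) by (auto simp: D'_def)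
    qed
    have drop: "supp f \<subseteq> D' \<longleftrightarrow> supp f \<subseteq> D \<and> coef f m = 0" for f :: "(nat, 'k) mps"
      by (auto simp: D'_def supp_def)
    show ?case
    proof (cases "m \<in> L")
      case True
      then obtain f where f: "f \<in> P" "homogeneous (mdeg y) \<alpha> f" "is_lead gt f m"
        by (auto simp: L_def leads_def)
      have "supp f \<subseteq> D"
      proof
        fix m' assume m': "m' \<in> supp f"
        then have "m' \<in> M" using f(2) P_polys[OF f(1)] by (auto simp: M_def polys_def homogeneous_def)
        moreover have "m' = m \<or> gt m m'" using f(3) m' by (auto simp: is_lead_def)
        ultimately show "m' \<in> D" using Suc(4) m(1) by blast
      qed
      have fm: "coef f m \<noteq> 0" using f(3) by (simp add: is_lead_def supp_def)
      have "?cls ` {f. supp f \<subseteq> D} \<subseteq> ?cls ` {f. supp f \<subseteq> D'}"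
      proof
        fix x assume "x \<in> ?cls ` {f. supp f \<subseteq> D}"
        then obtain q where q: "supp q \<subseteq> D" "x = ?cls q" by blast
        let ?c = "coef q m / coef f m"
        let ?r = "monomial 0 ?c * f"
        have "supp ?r \<subseteq> D" using \<open>supp f \<subseteq> D\<close> by (auto simp: supp_def)
        then have "supp (q - ?r) \<subseteq> D'" unfolding drop using q(1) supp_diff[of q ?r] fm by auto
        moreover have "?cls q = ?cls (q - ?r)"
          unfolding cls_eq using P_mult[OF const f(1)] by simp
        ultimately show "x \<in> ?cls ` {f. supp f \<subseteq> D'}" using q(2) by blast
      qed
      then have "?cls ` {f. supp f \<subseteq> D} = ?cls ` {f. supp f \<subseteq> D'}" using D'_def by blast
      moreover have "D - L = D' - L" using True by (auto simp: D'_def)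
      ultimately show ?thesis using IH by simp
    next
      case False
      let ?E = "?cls ` {f. supp f \<subseteq> D'}"
      have mon: "monomial m (1 :: 'k) \<in> polys V"
        using mM by (simp add: polys_def supp_monomial M_def)
      have not_in: "?cls (monomial m 1) \<notin> ?E"
      proof
        assume "?cls (monomial m 1) \<in> ?E"
        then obtain q where q: "supp q \<subseteq> D'" "?cls (monomial m 1) = ?cls q" by blast
        then have "monomial m 1 - q \<in> P" by (simp add: cls_eq)
        moreover have supp: "supp (monomial m 1 - q) \<subseteq> D"
          using supp_diff[of "monomial m 1" q] q(1) m(1) by (auto simp: D'_def supp_monomial)
        then have "homogeneous (mdeg y) \<alpha> (monomial m 1 - q)"
          using Suc(3) by (auto simp: homogeneous_def M_def)
        moreover have "coef q m = 0" using q(1) drop by blast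
        then have "m \<in> supp (monomial m 1 - q)" by (simp add: supp_def coef_monomial)
        then have "is_lead gt (monomial m 1 - q) m"
          using supp m(2) by (auto simp: is_lead_def)
        ultimately show False using False by (auto simp: L_def leads_def)
      qed
      have ext: "h.S.line_extension ?K (?cls (monomial m 1)) ?E = ?cls ` {f. supp f \<subseteq> D}"
      proof -
        have comb: "?cls (monomial 0 c) \<otimes>\<^bsub>?Q\<^esub> ?cls (monomial m 1) \<oplus>\<^bsub>?Q\<^esub> ?cls q = ?cls (monomial m c + q)"
          if "supp q \<subseteq> D'" for c q
        proof -
          have q: "q \<in> polys V" using that Suc(3) by (intro polysI) (auto simp: D'_def)
          have carr: "monomial 0 c \<in> carrier ?A" "monomial m 1 \<in> carrier ?A" "q \<in> carrier ?A"
            "monomial m c \<in> carrier ?A"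
            using const[of c] mon q by (auto simp: polys_def supp_monomial split: if_splits)
          have "?cls (monomial 0 c) \<otimes>\<^bsub>?Q\<^esub> ?cls (monomial m 1) = ?cls (monomial m c)"
            using h.hom_mult[OF carr(1,2)] by (simp only: mps_ring_simps monomial_mult add_0 mult_1_right)
          then show ?thesis
            using h.hom_add[OF carr(4,3)] by (simp only: mps_ring_simps)
        qed
        have mem: "x \<in> h.S.line_extension ?K (?cls (monomial m 1)) ?E \<longleftrightarrow>
            (\<exists>k\<in>?K. \<exists>e\<in>?E. x = k \<otimes>\<^bsub>?Q\<^esub> ?cls (monomial m 1) \<oplus>\<^bsub>?Q\<^esub> e)" for x
          unfolding h.S.line_extension_def set_add_def' r_coset_def by auto
        show ?thesis
        proof (intro equalityI subsetI)
          fix x assume "x \<in> h.S.line_extension ?K (?cls (monomial m 1)) ?E"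
          then obtain k e where ke: "k \<in> ?K" "e \<in> ?E" "x = k \<otimes>\<^bsub>?Q\<^esub> ?cls (monomial m 1) \<oplus>\<^bsub>?Q\<^esub> e"
            unfolding mem by (elim bexE)
          obtain c where c: "k = ?cls (monomial 0 c)" using ke(1) by (elim imageE) simp
          obtain q where q: "e = ?cls q" "supp q \<subseteq> D'" using ke(2) by (elim imageE CollectE)
          have "supp (monomial m c + q) \<subseteq> D"
            using supp_add[of "monomial m c" q] q(2) m(1) by (auto simp: D'_def supp_monomial split: if_splits)
          moreover have "x = ?cls (monomial m c + q)" unfolding ke(3) c q(1) by (rule comb[OF q(2)])
          ultimately show "x \<in> ?cls ` {f. supp f \<subseteq> D}" by (intro image_eqI CollectI)
        next
          fix x assume "x \<in> ?cls ` {f. supp f \<subseteq> D}"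
          then obtain f where f: "x = ?cls f" "supp f \<subseteq> D" by (elim imageE CollectE)
          let ?q = "f - monomial m (coef f m)"
          have q: "supp ?q \<subseteq> D'" unfolding drop
            using f(2) supp_diff[of f "monomial m (coef f m)"] m(1)
            by (auto simp: supp_monomial coef_monomial split: if_splits)
          have "?cls f = ?cls (monomial m (coef f m) + ?q)" by (simp only: add_diff_cancel_left' add_diff_eq)
          then have "x = ?cls (monomial 0 (coef f m)) \<otimes>\<^bsub>?Q\<^esub> ?cls (monomial m 1) \<oplus>\<^bsub>?Q\<^esub> ?cls ?q"
            unfolding f(1) comb[OF q] .
          then show "x \<in> h.S.line_extension ?K (?cls (monomial m 1)) ?E"
            unfolding mem using q by (intro bexI[of _ "?cls (monomial 0 (coef f m))"] bexI[of _ "?cls ?q"] imageI CollectI rangeI)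
        qed
      qed
      have "?cls (monomial m 1) \<in> carrier ?Q" using h.hom_closed mon by simp
      from h.S.dimension.Suc_dim[OF this not_in IH]
      have "h.S.dimension (Suc (card (D' - L))) ?K (?cls ` {f. supp f \<subseteq> D})" unfolding ext .
      moreover have "card (D - L) = Suc (card (D' - L))"
      proof -
        have "D - L = insert m (D' - L)" using m(1) False by (auto simp: D'_def)
        then show ?thesis using \<open>finite D\<close> by (simp add: D'_def)
      qed
      ultimately show ?thesis by simp
    qed
  qed
  have "{f \<in> polys V. homogeneous (mdeg y) \<alpha> f} = {f :: (nat, 'k) mps. supp f \<subseteq> M}"
    using polysI by (auto simp: polys_def M_def homogeneous_def)
  then have "h.S.dimension (card (M - L)) ?K (?cls ` {f \<in> carrier ?A. homogeneous (mdeg y) \<alpha> f})"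
    using step[of M] by simp
  then have "h.S.dim ?K (?cls ` {f \<in> carrier ?A. homogeneous (mdeg y) \<alpha> f}) = card (M - L)"
    by (intro dim_eq[OF P.quotient_is_ring] h.img_is_subfield(2)[OF subfield_constants])
  moreover have "M - L = {m. vars m \<subseteq> V \<and> mdeg y m = \<alpha> \<and> m \<notin> L}" by (auto simp: M_def)
  ultimately show ?thesis by (simp add: hilbert_series_def Let_def L_def)
qed

end


section \<open>Multiplication by \<open>\<Prod>(1 - x\<^sub>i)\<close>\<close>

definition one_minus_vars :: "'v set \<Rightarrow> ('v, int) mps" where
  "one_minus_vars V = (\<Prod>i\<in>V. 1 - monomial (var_mon i) 1)"

definition indicator_series :: "'v mon set \<Rightarrow> ('v, int) mps" where
  "indicator_series S = MPS (\<lambda>m. if m \<in> S then 1 else 0)"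

lemma coef_indicator_series [simp]: "coef (indicator_series S) m = (if m \<in> S then 1 else 0)"
  by (simp add: indicator_series_def)

lemma supp_indicator_series [simp]: "supp (indicator_series S) = S"
  by (simp add: supp_def)

lemma coef_one_minus_var_mult:
  fixes f :: "('v, int) mps"
  shows "coef ((1 - monomial (var_mon i) 1) * f) m = coef f m - (if i \<in> vars m then coef f (m - var_mon i) else 0)"
  by (simp add: left_diff_distrib coef_monomial_mult var_mon_minus_iff)

lemma polys_mult: "f \<in> polys V \<Longrightarrow> g \<in> polys V \<Longrightarrow> f * g \<in> polys V"
  for f g :: "('v, 'a::comm_ring_1) mps"
  using monoid.m_closed[OF ring.is_monoid[OF cring.axioms(1)[OF cring_polynomial_ring]], of f V g] by simp

lemma one_minus_vars_polys: "finite V \<Longrightarrow> one_minus_vars V \<in> polys V"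
proof (induction V rule: finite_induct)
  case empty
  show ?case by (simp add: one_minus_vars_def polys_def supp_0_1)
next
  case (insert i V)
  have supp: "supp (1 - monomial (var_mon i) 1 :: ('a, int) mps) \<subseteq> {0, var_mon i}"
    by (auto simp: supp_def coef_1 coef_monomial split: if_splits)
  then have "1 - monomial (var_mon i) 1 \<in> (polys (insert i V) :: ('a, int) mps set)"
    using finite_subset[OF supp] by (auto intro!: polys_memI)
  moreover have "one_minus_vars V \<in> polys (insert i V)"
    using insert(3) by (auto simp: polys_def)
  ultimately show ?case using insert(1,2) by (simp add: one_minus_vars_def polys_mult)
qed

text \<open>
  A further factor \<open>1 - x\<^sub>k\<close> changes only coefficients at monomials divisible by \<open>x\<^sub>k\<close>, so the partial
  products are eventually constant at each monomial.
\<close>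

lemma coef_mu:
  assumes "vars a \<subseteq> {..<n}"
  shows "coef mu a = coef (one_minus_vars {..<n}) a"
proof -
  have "coef (one_minus_vars {..<n + k}) a = coef (one_minus_vars {..<n}) a" for k
  proof (induction k)
    case (Suc k)
    have "one_minus_vars {..<n + Suc k} = (1 - monomial (var_mon (n + k)) 1) * one_minus_vars {..<n + k}"
      by (simp add: one_minus_vars_def lessThan_Suc)
    moreover have "n + k \<notin> vars a" using assms by auto
    ultimately show ?case using Suc by (simp add: coef_one_minus_var_mult)
  qed simp
  then have "coef (one_minus_vars {..<k}) a = coef (one_minus_vars {..<n}) a" if "n \<le> k" for k
    using that by (metis le_add_diff_inverse)
  then have "(\<lambda>k. coef (one_minus_vars {..<k}) a) \<longlonglongrightarrow> coef (one_minus_vars {..<n}) a"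
    by (intro tendsto_eventually eventually_sequentiallyI)
  then show ?thesis
    unfolding mu_def coef_MPS one_minus_vars_def[symmetric] by (rule limI)
qed

lemma coef_mu_mult:
  assumes "vars m \<subseteq> {..<n}"
  shows "coef (mu * f) m = coef (one_minus_vars {..<n} * f) m"
proof -
  have "coef mu a = coef (one_minus_vars {..<n}) a" if "(a, b) \<in> antidiag m" for a b
    using that assms by (intro coef_mu) auto
  then show ?thesis unfolding coef_mult by (intro sum.cong) auto
qed

text \<open>
  The factor \<open>1 - x\<^sub>i\<close> takes differences in the direction of \<open>x\<^sub>i\<close>, and the other factors do not change
  the exponent of \<open>x\<^sub>i\<close>. So only the differences of \<open>f\<close> at divisors of \<open>m\<close> with the same exponent of
  \<open>x\<^sub>i\<close> enter, and these vanish.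
\<close>

lemma coef_one_minus_vars_mult_eq_0:
  assumes V: "finite V" "i \<in> V" and i: "i \<in> vars m"
    and eq: "\<And>a b. a + b = m \<Longrightarrow> expo b i = expo m i \<Longrightarrow> coef f (b - var_mon i) = coef f b"
  shows "coef (one_minus_vars V * f) m = 0"
proof -
  let ?Q = "one_minus_vars (V - {i})" and ?g = "(1 - monomial (var_mon i) 1) * f"
  have "one_minus_vars V = (1 - monomial (var_mon i) 1) * ?Q"
    unfolding one_minus_vars_def using V by (rule prod.remove)
  then have "coef (one_minus_vars V * f) m = coef (?Q * ?g) m"
    by (simp add: mult_ac)
  also have "\<dots> = 0"
    unfolding coef_mult[of ?Q ?g]
  proof (rule sum.neutral, rule ballI)
    fix p assume "p \<in> antidiag m"
    then obtain a b where p: "p = (a, b)" and m: "a + b = m" by (cases p) auto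
    have "coef ?g b = 0" if "coef ?Q a \<noteq> 0"
    proof -
      have "i \<notin> vars a"
        using that one_minus_vars_polys[of "V - {i}"] V(1) by (auto simp: polys_def supp_def)
      then have "expo b i = expo m i" "i \<in> vars b" using m i by (auto simp: in_vars_iff)
      then show ?thesis using eq[OF m] unfolding coef_one_minus_var_mult by simp
    qed
    then show "(case p of (a, b) \<Rightarrow> coef ?Q a * coef ?g b) = 0" unfolding p by auto
  qed
  finally show ?thesis .
qed


section \<open>The substitution homomorphism\<close>

lemma coef_kappa:
  fixes f :: "('v, 'a::comm_ring_1) mps"
  assumes "finite A" "A \<subseteq> {m. mdeg y m = \<alpha>}" "{m \<in> supp f. mdeg y m = \<alpha>} \<subseteq> A"
  shows "coef (kappa y f) \<alpha> = (\<Sum>m\<in>A. coef f m)"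
  unfolding kappa_def coef_MPS using assms by (intro sum.mono_neutral_left) (auto simp: supp_def)

lemma loc_finite_fibre:
  assumes "f \<in> loc_finite" shows "finite {m \<in> supp f. mdeg y m = \<alpha>}"
  by (rule finite_subset[of _ "{m \<in> supp f. tdeg m = tdeg \<alpha>}"]) (use assms in \<open>auto simp: loc_finite_def\<close>)

lemma polys_loc_finite: "f \<in> polys V \<Longrightarrow> f \<in> loc_finite"
  by (auto simp: polys_def loc_finite_def)

text \<open>
  At \<open>\<alpha>\<close>, both sides sum the products of coefficients over the pairs of monomials whose
  multidegrees add up to \<open>\<alpha>\<close>. Local finiteness makes the set \<open>S\<close> of relevant pairs finite.
\<close>

lemma kappa_mult:
  fixes f g :: "('v, 'a::comm_ring_1) mps"
  assumes f: "f \<in> loc_finite" and g: "g \<in> loc_finite"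
  shows "kappa y (f * g) = kappa y f * kappa y g"
proof (rule mps_eqI)
  fix \<alpha>
  define F where "F = (\<lambda>\<beta>. {m \<in> supp f. mdeg y m = \<beta>})"
  define G where "G = (\<lambda>\<beta>. {m \<in> supp g. mdeg y m = \<beta>})"
  define S where "S = {(a, b). a \<in> supp f \<and> b \<in> supp g \<and> mdeg y a + mdeg y b = \<alpha>}"
  let ?t = "\<lambda>p. coef f (fst p) * coef g (snd p)"
  have fin: "finite (F \<beta>)" "finite (G \<beta>)" for \<beta>
    using loc_finite_fibre f g unfolding F_def G_def by blast+
  have S_eq: "S = (\<Union>q\<in>antidiag \<alpha>. F (fst q) \<times> G (snd q))"
  proof (intro equalityI subsetI)
    fix p assume "p \<in> S"
    then show "p \<in> (\<Union>q\<in>antidiag \<alpha>. F (fst q) \<times> G (snd q))"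
      by (intro UN_I[of "(mdeg y (fst p), mdeg y (snd p))"]) (auto simp: S_def F_def G_def)
  qed (auto simp: S_def F_def G_def)
  have "finite S" unfolding S_eq using fin by auto
  let ?plus = "\<lambda>p. fst p + snd p"
  have "coef (kappa y (f * g)) \<alpha> = (\<Sum>m\<in>?plus ` S. coef (f * g) m)"
  proof (rule coef_kappa)
    show "{m \<in> supp (f * g). mdeg y m = \<alpha>} \<subseteq> ?plus ` S"
    proof
      fix m assume "m \<in> {m \<in> supp (f * g). mdeg y m = \<alpha>}"
      then have m: "m \<in> supp (f * g)" "mdeg y m = \<alpha>" by auto
      obtain u w where uw: "m = u + w" "u \<in> supp f" "w \<in> supp g" using m(1) by (rule supp_multE)
      then have "(u, w) \<in> S" using m(2) by (simp add: S_def mdeg_add)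
      then show "m \<in> ?plus ` S" by (rule image_eqI[rotated]) (simp add: uw(1))
    qed
  qed (use \<open>finite S\<close> in \<open>auto simp: S_def mdeg_add\<close>)
  also have "\<dots> = (\<Sum>m\<in>?plus ` S. \<Sum>p\<in>{p\<in>S. ?plus p = m}. ?t p)"
  proof (rule sum.cong[OF refl])
    fix m assume "m \<in> ?plus ` S"
    then have "mdeg y m = \<alpha>" by (auto simp: S_def mdeg_add)
    then have zero: "?t p = 0" if "p \<in> antidiag m - {p\<in>S. ?plus p = m}" for p
    proof (rule_tac ccontr)
      assume "?t p \<noteq> 0"
      then have "fst p \<in> supp f" "snd p \<in> supp g" unfolding supp_def by auto
      moreover have m: "fst p + snd p = m" using that by (cases p) simp
      moreover have "mdeg y (fst p) + mdeg y (snd p) = \<alpha>"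
        using \<open>mdeg y m = \<alpha>\<close> by (simp only: m mdeg_add[symmetric])
      ultimately have "p \<in> {p\<in>S. ?plus p = m}" unfolding S_def by (cases p) simp
      with that show False by blast
    qed
    have sub: "{p\<in>S. ?plus p = m} \<subseteq> antidiag m" by (auto simp: antidiag_def)
    show "coef (f * g) m = (\<Sum>p\<in>{p\<in>S. ?plus p = m}. ?t p)"
      unfolding coef_mult case_prod_unfold
      by (rule sum.mono_neutral_right[OF finite_antidiag sub]) (use zero in blast)
  qed
  also have "\<dots> = (\<Sum>p\<in>S. ?t p)"
    by (rule sum.group[OF \<open>finite S\<close> finite_imageI[OF \<open>finite S\<close>] subset_refl])
  also have "\<dots> = (\<Sum>q\<in>antidiag \<alpha>. \<Sum>p\<in>F (fst q) \<times> G (snd q). ?t p)"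
    unfolding S_eq
  proof (rule sum.UNION_disjoint)
    show "\<forall>q\<in>antidiag \<alpha>. finite (F (fst q) \<times> G (snd q))" using fin by simp
    show "\<forall>q\<in>antidiag \<alpha>. \<forall>q'\<in>antidiag \<alpha>. q \<noteq> q' \<longrightarrow>
        F (fst q) \<times> G (snd q) \<inter> F (fst q') \<times> G (snd q') = {}"
      by (auto simp: F_def G_def prod_eq_iff)
  qed simp
  also have "\<dots> = (\<Sum>q\<in>antidiag \<alpha>. (\<Sum>a\<in>F (fst q). coef f a) * (\<Sum>b\<in>G (snd q). coef g b))"
    by (simp add: sum_product sum.cartesian_product case_prod_unfold)
  also have "\<dots> = coef (kappa y f * kappa y g) \<alpha>"
    unfolding coef_mult by (simp add: kappa_def F_def G_def case_prod_unfold)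
  finally show "coef (kappa y (f * g)) \<alpha> = coef (kappa y f * kappa y g) \<alpha>" .
qed

lemma kappa_one_minus_var:
  "kappa y (1 - monomial (var_mon i) 1) = (1 - monomial (var_mon (y i)) 1 :: ('r, int) mps)"
proof (rule mps_eqI)
  fix \<alpha>
  let ?f = "1 - monomial (var_mon i) 1 :: ('a, int) mps"
  have "supp ?f \<subseteq> {0, var_mon i}"
    by (auto simp: supp_def coef_1 coef_monomial split: if_splits)
  then have "coef (kappa y ?f) \<alpha> = (\<Sum>m\<in>{m\<in>{0, var_mon i}. mdeg y m = \<alpha>}. coef ?f m)"
    by (intro coef_kappa) auto
  also have "\<dots> = (\<Sum>m\<in>{0, var_mon i}. if mdeg y m = \<alpha> then coef ?f m else 0)"
    by (intro sum.inter_filter) auto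
  also have "\<dots> = coef (1 - monomial (var_mon (y i)) 1) \<alpha>"
    by (auto simp: coef_1 coef_monomial mdeg_var_mon)
  finally show "coef (kappa y ?f) \<alpha> = coef (1 - monomial (var_mon (y i)) 1) \<alpha>" .
qed

lemma kappa_one: "kappa y 1 = (1 :: ('r, int) mps)"
proof (rule mps_eqI)
  fix \<alpha>
  have "coef (kappa y (1 :: ('a, int) mps)) \<alpha> = (\<Sum>m\<in>(if \<alpha> = 0 then {0} else {}). coef (1 :: ('a, int) mps) m)"
    by (rule coef_kappa) (auto simp: supp_0_1)
  then show "coef (kappa y (1 :: ('a, int) mps)) \<alpha> = coef 1 \<alpha>" by (simp add: coef_1)
qed

lemma kappa_one_minus_vars:
  "finite V \<Longrightarrow> kappa y (one_minus_vars V) = (\<Prod>i\<in>V. 1 - monomial (var_mon (y i)) 1)"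
proof (induction V rule: finite_induct)
  case (insert i V)
  have "1 - monomial (var_mon i) 1 = one_minus_vars {i}" by (simp add: one_minus_vars_def)
  then have "1 - monomial (var_mon i) (1 :: int) \<in> loc_finite"
    using polys_loc_finite[OF one_minus_vars_polys[of "{i}"]] by simp
  then have "kappa y ((1 - monomial (var_mon i) 1) * one_minus_vars V) =
      kappa y (1 - monomial (var_mon i) 1) * kappa y (one_minus_vars V)"
    using polys_loc_finite[OF one_minus_vars_polys[OF insert(1)]] by (rule kappa_mult)
  with insert show ?case
    by (simp add: one_minus_vars_def kappa_one_minus_var)
qed (simp add: one_minus_vars_def kappa_one)

lemma kappa_polys:
  fixes f :: "('v, 'a::comm_ring_1) mps"
  assumes "f \<in> polys V" shows "kappa y f \<in> polys UNIV"
proof -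
  have "supp (kappa y f) \<subseteq> mdeg y ` supp f"
  proof
    fix \<alpha> assume "\<alpha> \<in> supp (kappa y f)"
    then have "(\<Sum>m | m \<in> supp f \<and> mdeg y m = \<alpha>. coef f m) \<noteq> 0"
      by (simp add: supp_def kappa_def)
    then have "{m \<in> supp f. mdeg y m = \<alpha>} \<noteq> {}" by (metis sum.empty)
    then show "\<alpha> \<in> mdeg y ` supp f" by blast
  qed
  then show ?thesis using assms finite_subset by (auto simp: polys_def)
qed


section \<open>The adic topology\<close>

text \<open>
  Choosing a variable in each nonconstant monomial splits a series of order at least \<open>d + 1\<close> into
  finitely many multiples of variables, with cofactors of order at least \<open>d\<close>.
\<close>

lemma mem_ideal_power:
  fixes h :: "('r::finite, int) mps"
  assumes "\<And>\<alpha>. tdeg \<alpha> < d \<Longrightarrow> coef h \<alpha> = 0"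
  shows "h \<in> ideal_power (mps_ring UNIV) (Idl\<^bsub>mps_ring UNIV\<^esub> range (\<lambda>i. monomial (var_mon i) 1)) d"
  using assms
proof (induction d arbitrary: h)
  case (Suc d)
  let ?R = "mps_ring UNIV :: ('r, int) mps ring"
  let ?I = "Idl\<^bsub>?R\<^esub> range (\<lambda>i. monomial (var_mon i) 1)"
  interpret R: cring ?R by (rule cring_mps_ring) auto
  define c :: "'r mon \<Rightarrow> 'r" where "c m = (SOME i. i \<in> vars m)" for m
  have c: "c m \<in> vars m" if "m \<noteq> 0" for m
  proof -
    have "vars m \<noteq> {}" using that in_vars_iff mon_eqI[of m 0] by fastforce
    then show ?thesis unfolding c_def by (simp add: some_in_eq)
  qed
  define q where "q = (\<lambda>i. MPS (\<lambda>m. if c (m + var_mon i) = i then coef h (m + var_mon i) else 0))"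
  have h: "h = (\<Sum>i\<in>UNIV. q i * monomial (var_mon i) 1)"
  proof (rule mps_eqI)
    fix m
    have coefs: "coef (monomial (var_mon i) 1 * q i) m = (if m \<noteq> 0 \<and> i = c m then coef h m else 0)" for i
    proof (cases "i \<in> vars m")
      case True
      then have "m - var_mon i + var_mon i = m" "m \<noteq> 0"
        using var_mon_minus[OF True] by (auto simp: add.commute)
      then show ?thesis using var_mon_minus[OF True] by (simp add: coef_monomial_mult q_def) auto
    next
      case False
      then show ?thesis using c[of m] by (auto simp: coef_monomial_mult var_mon_minus_iff)
    qed
    have "coef (\<Sum>i\<in>UNIV. q i * monomial (var_mon i) 1) m
        = (\<Sum>i\<in>UNIV. if m \<noteq> 0 \<and> i = c m then coef h m else 0)"
      by (simp only: coef_sum mult.commute[of "q _"] coefs)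
    also have "\<dots> = (if m \<noteq> 0 then coef h m else 0)" by (cases "m = 0") simp_all
    finally have "coef (\<Sum>i\<in>UNIV. q i * monomial (var_mon i) 1) m = (if m \<noteq> 0 then coef h m else 0)" .
    moreover have "coef h 0 = 0" by (rule Suc(2)) simp
    ultimately show "coef h m = coef (\<Sum>i\<in>UNIV. q i * monomial (var_mon i) 1) m" by simp
  qed
  let ?P = "ideal_prod ?R (ideal_power ?R ?I d) ?I"
  have summand: "q i * monomial (var_mon i) 1 \<in> ?P" for i
  proof -
    have "q i \<in> ideal_power ?R ?I d"
    proof (rule Suc(1))
      fix \<alpha> :: "'r mon" assume "tdeg \<alpha> < d"
      then show "coef (q i) \<alpha> = 0" using Suc(2)[of "\<alpha> + var_mon i"] by (simp add: q_def tdeg_add)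
    qed
    moreover have "monomial (var_mon i) 1 \<in> ?I"
      using R.genideal_self[of "range (\<lambda>i. monomial (var_mon i) 1)"] by auto
    ultimately show ?thesis using ideal_prod.prod[of "q i" _ "monomial (var_mon i) 1" ?I ?R] by simp
  qed
  have "(\<Sum>i\<in>A. q i * monomial (var_mon i) 1) \<in> ?P" if "finite A" "A \<noteq> {}" for A
    using that
  proof (induction A rule: finite_ne_induct)
    case (insert i A)
    then show ?case using ideal_prod.sum[OF summand[of i] insert(4)] by simp
  qed (simp add: summand)
  then show ?case using h by simp
qed simp


section \<open>Convergence of the numerators\<close>

context lfg_ideal begin

text \<open>
  The monomials in the first \<open>n\<close> variables that are not leading monomials of the truncated ideal, tested
  on elements homogeneous for the multigrading as required by \<open>coef_hilbert_series\<close>.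
\<close>

definition standard :: "(nat \<Rightarrow> 'r) \<Rightarrow> nat \<Rightarrow> nat mon set" where
  "standard y n = {m. vars m \<subseteq> {..<n} \<and>
     m \<notin> leads gt {f \<in> trunc n ` I. homogeneous (mdeg y) (mdeg y m) f}}"

lemma hilbert_series_eq:
  "hilbert_series y {..<n} (trunc n ` I) = kappa y (indicator_series (standard y n))"
proof (rule mps_eqI)
  fix \<alpha>
  let ?A = "{m \<in> standard y n. mdeg y m = \<alpha>}"
  have "finite ?A"
    by (rule finite_subset[OF _ finite_mons_mdeg[of "{..<n}" y \<alpha>]]) (auto simp: standard_def)
  then have "coef (kappa y (indicator_series (standard y n))) \<alpha> = (\<Sum>m\<in>?A. coef (indicator_series (standard y n)) m)"
    by (intro coef_kappa) auto
  also have "\<dots> = int (card ?A)" by simp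
  also have "?A = {m. vars m \<subseteq> {..<n} \<and> mdeg y m = \<alpha> \<and>
      m \<notin> leads gt {f\<in>trunc n ` I. homogeneous (mdeg y) \<alpha> f}}" by (auto simp: standard_def)
  finally show "coef (hilbert_series y {..<n} (trunc n ` I)) \<alpha>
      = coef (kappa y (indicator_series (standard y n))) \<alpha>"
    using coef_hilbert_series[OF _ ideal_trunc[OF ideal_I]] by simp
qed

lemma loc_finite_standard: "indicator_series (standard y n) \<in> loc_finite"
  unfolding loc_finite_def
proof safe
  fix d
  show "finite {m \<in> supp (indicator_series (standard y n)). tdeg m = d}"
    by (rule finite_subset[OF _ finite_mons_tdeg_le[of "{..<n}" d]]) (auto simp: standard_def)
qed

lemma numerator_eq:
  "hilbert_series y {..<n} (trunc n ` I) * (\<Prod>i<n. 1 - monomial (var_mon (y i)) 1)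
    = kappa y (one_minus_vars {..<n} * indicator_series (standard y n))"
  by (simp add: hilbert_series_eq kappa_mult loc_finite_standard polys_loc_finite[OF one_minus_vars_polys]
      kappa_one_minus_vars mult.commute)

lemma nonstandard_add:
  assumes m: "vars m \<subseteq> {..<n}" "m \<notin> standard y n" and u: "vars u \<subseteq> {..<n}"
  shows "m + u \<notin> standard y n"
proof -
  obtain f where f: "f \<in> I" "homogeneous (mdeg y) (mdeg y m) (trunc n f)" "is_lead gt (trunc n f) m"
    using m by (auto simp: standard_def leads_def)
  have "monomial u (1 :: 'k) \<in> polys {..<n}" using u by (simp add: polys_def supp_monomial)
  then have eq: "monomial u 1 * trunc n f = trunc n (monomial u 1 * f)"
    by (simp only: trunc_mult trunc_polys)
  have "homogeneous (mdeg y) (mdeg y (m + u)) (monomial u 1 * trunc n f)"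
    unfolding homogeneous_def
  proof
    fix m' assume "m' \<in> supp (monomial u 1 * trunc n f)"
    then obtain u' w where "m' = u' + w" "u' \<in> supp (monomial u (1 :: 'k))" "w \<in> supp (trunc n f)"
      by (rule supp_multE)
    then show "mdeg y m' = mdeg y (m + u)"
      using f(2) by (simp add: supp_monomial mdeg_add homogeneous_def add.commute)
  qed
  moreover have "is_lead gt (monomial u 1 * trunc n f) (m + u)"
    using is_lead_monomial_mult[OF f(3), of u] by (simp add: add.commute)
  moreover have "monomial u 1 * trunc n f \<in> trunc n ` I"
    unfolding eq using I_mult[OF monomial_bounded f(1)] by blast
  ultimately show ?thesis unfolding standard_def leads_def by blast
qed

text \<open>
  By Dickson's lemma the nonstandard monomials have finitely many generators. Once the exponent of
  \<open>x\<^sub>i\<close> exceeds those in all generators, lowering it by one does not affect standardness, and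
  \<open>coef_one_minus_vars_mult_eq_0\<close> applies.
\<close>

lemma numerator_finite: "one_minus_vars {..<n} * indicator_series (standard y n) \<in> polys {..<n}"
proof -
  let ?f = "one_minus_vars {..<n} * indicator_series (standard y n)"
  define U where "U = {m. vars m \<subseteq> {..<n} \<and> m \<notin> standard y n}"
  have "\<exists>F. finite F \<and> F \<subseteq> U \<and> (\<forall>m\<in>U. \<exists>b\<in>F. \<exists>c. m = b + c)"
    by (rule dickson[of "{..<n}"]) (simp_all add: U_def)
  then obtain F where F: "finite F" "F \<subseteq> U" "\<forall>m\<in>U. \<exists>b\<in>F. \<exists>c. m = b + c" by (elim exE conjE)
  \<comment> \<open>A crude common bound for all exponents in the generators \<open>F\<close>.\<close>
  define B where "B = (\<Sum>b\<in>F. tdeg b)"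
  have B: "expo b i \<le> B" if "b \<in> F" for b i
    unfolding B_def by (rule order_trans[OF expo_le_tdeg member_le_sum[OF that _ F(1)]]) simp
  have vars: "vars m \<subseteq> {..<n}" if m: "m \<in> supp ?f" for m
  proof -
    obtain u w where "m = u + w" "u \<in> supp (one_minus_vars {..<n})" "w \<in> supp (indicator_series (standard y n))"
      using m by (rule supp_multE)
    moreover from this have "vars u \<subseteq> {..<n}" using one_minus_vars_polys[of "{..<n}"] by (simp add: polys_def)
    ultimately show ?thesis by (simp add: standard_def)
  qed
  have "expo m i \<le> B" if m: "m \<in> supp ?f" and "i < n" for m i
  proof (rule ccontr)
    assume big: "\<not> expo m i \<le> B"
    have "coef ?f m = 0"
    proof (rule coef_one_minus_vars_mult_eq_0)
      show "i \<in> vars m" using big by (simp add: in_vars_iff)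
      fix a b assume ab: "a + b = m" "expo b i = expo m i"
      have b: "vars b \<subseteq> {..<n}" using vars[OF m] ab(1) by auto
      have "i \<in> vars b" using ab(2) big by (simp add: in_vars_iff)
      then have b_eq: "var_mon i + (b - var_mon i) = b" by (rule var_mon_minus)
      have b': "vars (b - var_mon i) \<subseteq> {..<n}" by (rule order_trans[OF vars_diff b])
      have "b - var_mon i \<in> U" if bU: "b \<in> U"
      proof -
        obtain b0 c where c: "b0 \<in> F" "b = b0 + c" using bspec[OF F(3) bU] by auto
        have "expo c i > 0" using B[OF c(1), of i] big ab(2) c(2) by simp
        then have "b - var_mon i = b0 + (c - var_mon i)"
          unfolding c(2) by (intro mon_eqI) (auto simp: expo_var_mon)
        moreover have "b0 + (c - var_mon i) \<in> U"
        proof -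
          have "vars (c - var_mon i) \<subseteq> {..<n}" using b c(2) vars_diff[of c "var_mon i"] by auto
          moreover have "b0 \<in> U" using c(1) F(2) by blast
          ultimately show ?thesis using nonstandard_add[of b0 n y "c - var_mon i"] by (simp add: U_def)
        qed
        ultimately show ?thesis by simp
      qed
      moreover have "b \<in> U" if "b - var_mon i \<in> U"
      proof -
        have "(b - var_mon i) + var_mon i \<notin> standard y n"
          using that \<open>i < n\<close> by (intro nonstandard_add) (simp_all add: U_def)
        then show ?thesis using b b_eq by (simp add: U_def add.commute)
      qed
      ultimately have "b - var_mon i \<in> U \<longleftrightarrow> b \<in> U" by (rule iffI[rotated])
      then have "b - var_mon i \<in> standard y n \<longleftrightarrow> b \<in> standard y n"
        using b b' by (simp add: U_def)
      then show "coef (indicator_series (standard y n)) (b - var_mon i)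
          = coef (indicator_series (standard y n)) b"
        by simp
    qed (use \<open>i < n\<close> in auto)
    with m show False by (simp add: supp_def)
  qed
  then have "supp ?f \<subseteq> {m. vars m \<subseteq> {..<n} \<and> (\<forall>i\<in>{..<n}. expo m i \<le> B)}" using vars by auto
  then have "finite (supp ?f)" by (rule finite_subset) (simp add: finite_box)
  then show ?thesis using vars by (intro polys_memI)
qed

lemma p_series_eq: "p_series (initial_ideal gt I) = mu * indicator_series (- lead_mons)"
proof -
  have "MPS (\<lambda>m. 1 when monomial m 1 \<notin> initial_ideal gt I) = indicator_series (- lead_mons)"
    by (rule mps_eqI) (simp add: monomial_in_initial_ideal_iff when_def)
  then show ?thesis by (simp add: p_series_def)
qed

text \<open>
  For \<open>i \<ge> N\<close>, division by \<open>x\<^sub>i\<close> does not change the part in the first \<open>N\<close> variables, hence does not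
  affect membership in the initial ideal up to degree \<open>d\<close>.
\<close>

lemma vars_p_series:
  assumes N: "stable_upto {..<N} d" and m: "m \<in> supp (p_series (initial_ideal gt I))" "tdeg m \<le> d"
  shows "vars m \<subseteq> {..<N}"
proof (rule ccontr)
  assume "\<not> vars m \<subseteq> {..<N}"
  then obtain i where i: "i \<in> vars m" "N \<le> i" by (auto simp: subset_iff not_less)
  obtain n where n: "vars m \<subseteq> {..<n}" using finite_nat_iff_bounded[of "vars m"] by auto
  have "coef (one_minus_vars {..<n} * indicator_series (- lead_mons)) m = 0"
  proof (rule coef_one_minus_vars_mult_eq_0[OF _ _ i(1)])
    fix a b assume ab: "a + b = m" "expo b i = expo m i"
    have "i \<in> vars b" using ab(2) i(1) by (simp add: in_vars_iff)
    then have b: "var_mon i + (b - var_mon i) = b" by (rule var_mon_minus)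
    have "b - var_mon i \<in> lead_mons" if "b \<in> lead_mons"
    proof -
      have "tdeg b \<le> d" using ab(1) m(2) by (auto simp: tdeg_add)
      then have "part {..<N} b \<in> lead_mons" using N that by (simp add: stable_upto_def)
      moreover have "part {..<N} b = part {..<N} (b - var_mon i)"
        by (rule mon_eqI) (use i(2) in \<open>auto simp: expo_var_mon\<close>)
      ultimately show ?thesis using lead_mons_add part_compl by metis
    qed
    moreover have "b \<in> lead_mons" if "b - var_mon i \<in> lead_mons"
      using lead_mons_add[OF that, of "var_mon i"] b by (simp add: add.commute)
    ultimately show "coef (indicator_series (- lead_mons)) (b - var_mon i) = coef (indicator_series (- lead_mons)) b"
      by auto
  qed (use n i(1) in auto)
  then have "coef (p_series (initial_ideal gt I)) m = 0"
    unfolding p_series_eq coef_mu_mult[OF n] .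
  with m(1) show False by (simp add: supp_def)
qed

lemma p_series_loc_finite: "p_series (initial_ideal gt I) \<in> loc_finite"
  unfolding loc_finite_def
proof safe
  fix d
  obtain N where N: "stable_upto {..<N} d" using ex_stable_upto by blast
  have "{m \<in> supp (p_series (initial_ideal gt I)). tdeg m = d} \<subseteq> {m. vars m \<subseteq> {..<N} \<and> tdeg m \<le> d}"
    using vars_p_series[OF N] by auto
  then show "finite {m \<in> supp (p_series (initial_ideal gt I)). tdeg m = d}"
    by (rule finite_subset) (simp add: finite_mons_tdeg_le)
qed

text \<open>
  Replacing an element of \<open>I\<close> by its component in the multidegree of its leading monomial makes it
  homogeneous for the finer grading, so both gradings give the same leading monomials; the converse
  direction is \<open>leads_trunc\<close>.
\<close>

lemma standard_iff:
  assumes hom: "homogeneous_ideal (mdeg y) I" and n: "stable_upto {..<n} d"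
    and m: "vars m \<subseteq> {..<n}" "tdeg m \<le> d"
  shows "m \<in> standard y n \<longleftrightarrow> m \<notin> lead_mons"
proof -
  have "m \<in> leads gt {f \<in> trunc n ` I. homogeneous (mdeg y) (mdeg y m) f} \<longleftrightarrow> m \<in> lead_mons" (is "?L \<longleftrightarrow> _")
  proof
    assume ?L
    then obtain f where f: "f \<in> I" "homogeneous (mdeg y) (mdeg y m) (trunc n f)" "is_lead gt (trunc n f) m"
      by (auto simp: leads_def)
    have "homogeneous tdeg (tdeg m) (trunc n f)"
      using f(2) unfolding homogeneous_def by (metis tdeg_mdeg)
    then show "m \<in> lead_mons"
      using leads_trunc[OF stable_upto_mono[OF n subset_refl m(2)] f(1) _ f(3)] by simp
  next
    assume "m \<in> lead_mons"
    then obtain f where f: "f \<in> I" "is_lead gt f m" by (rule lead_monsE)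
    let ?f = "component (mdeg y) (mdeg y m) f"
    have "?f \<in> I" using hom f(1) by (simp add: homogeneous_ideal_def)
    moreover have "is_lead gt (trunc n ?f) m"
      by (intro is_lead_trunc is_lead_component f m)
    moreover have "homogeneous (mdeg y) (mdeg y m) (trunc n ?f)"
      unfolding trunc_component by simp
    ultimately show ?L unfolding leads_def by blast
  qed
  with m(1) show ?thesis by (simp add: standard_def)
qed

text \<open>
  In multidegree \<open>\<alpha>\<close> both series are supported in the first \<open>n\<close> variables, and there \<open>\<mu>\<close> may be
  replaced by its partial product and the complement of the leading monomials by \<open>standard y n\<close>.
\<close>

lemma coef_kappa_p_series:
  assumes hom: "homogeneous_ideal (mdeg y) I" and n: "stable_upto {..<n} d" and \<alpha>: "tdeg \<alpha> \<le> d"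
  shows "coef (kappa y (p_series (initial_ideal gt I))) \<alpha>
    = coef (kappa y (one_minus_vars {..<n} * indicator_series (standard y n))) \<alpha>"
proof -
  let ?A = "{m. vars m \<subseteq> {..<n} \<and> mdeg y m = \<alpha>}"
  have fin: "finite ?A" by (rule finite_mons_mdeg) simp
  have deg: "tdeg m \<le> d" if "mdeg y m = \<alpha>" for m using that \<alpha> by auto
  have "coef (kappa y (p_series (initial_ideal gt I))) \<alpha> = (\<Sum>m\<in>?A. coef (p_series (initial_ideal gt I)) m)"
    using vars_p_series[OF n] deg by (intro coef_kappa fin) auto
  also have "\<dots> = (\<Sum>m\<in>?A. coef (one_minus_vars {..<n} * indicator_series (standard y n)) m)"
  proof (rule sum.cong[OF refl])
    fix m assume m: "m \<in> ?A"
    have "coef (indicator_series (- lead_mons)) b = coef (indicator_series (standard y n)) b"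
      if "(a, b) \<in> antidiag m" for a b
    proof -
      have "vars b \<subseteq> {..<n}" "tdeg b \<le> d" using that m deg[of m] by (auto simp: tdeg_add)
      then show ?thesis using standard_iff[OF hom n] by simp
    qed
    then have "coef (one_minus_vars {..<n} * indicator_series (- lead_mons)) m
        = coef (one_minus_vars {..<n} * indicator_series (standard y n)) m"
      unfolding coef_mult by (intro sum.cong) auto
    then show "coef (p_series (initial_ideal gt I)) m
        = coef (one_minus_vars {..<n} * indicator_series (standard y n)) m"
      unfolding p_series_eq using m by (simp add: coef_mu_mult[of m n])
  qed
  also have "\<dots> = coef (kappa y (one_minus_vars {..<n} * indicator_series (standard y n))) \<alpha>"
    using numerator_finite[of n y] by (intro coef_kappa[symmetric] fin) (auto simp: polys_def)
  finally show ?thesis .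
qed

end

theorem theorem5p11:
  fixes gt :: "nat mon \<Rightarrow> nat mon \<Rightarrow> bool"
    and y :: "nat \<Rightarrow> 'r::finite"
    and I :: "(nat, 'k::field_char_0) mps set"
    and g :: "nat \<Rightarrow> ('r, int) mps"
  assumes "term_order gt"
    and "ideal I bounded_ring"
    and "homogeneous_ideal (mdeg y) I"
    and "locally_fin_gen I"
    and "\<And>n. n \<ge> 1 \<Longrightarrow>
           hilbert_series y {..<n} (trunc n ` I) * (\<Prod>i<n. 1 - monomial (var_mon (y i)) 1) = g n"
  shows "(\<forall>n\<ge>1. g n \<in> polys UNIV) \<and>
         p_series (initial_ideal gt I) \<in> loc_finite \<and>
         adic_tendsto g (kappa y (p_series (initial_ideal gt I)))"
proof -
  interpret lfg_ideal gt I
    by (intro lfg_ideal.intro term_ordered.intro lfg_ideal_axioms.intro) (fact assms)+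
  have g: "g n = kappa y (one_minus_vars {..<n} * indicator_series (standard y n))" if "n \<ge> 1" for n
    using assms(5)[OF that] by (simp add: numerator_eq)
  have "adic_tendsto g (kappa y (p_series (initial_ideal gt I)))"
    unfolding adic_tendsto_def
  proof (intro allI)
    fix d
    obtain N where N: "stable_upto {..<N} d" using ex_stable_upto by blast
    show "\<forall>\<^sub>F n in sequentially. g n - kappa y (p_series (initial_ideal gt I)) \<in>
        ideal_power (mps_ring UNIV) (Idl\<^bsub>mps_ring UNIV\<^esub> range (\<lambda>i. monomial (var_mon i) 1)) d"
    proof (rule eventually_sequentiallyI)
      fix n assume "max 1 N \<le> n"
      then have n: "n \<ge> 1" "stable_upto {..<n} d" using stable_upto_mono[OF N, of "{..<n}" d] by auto
      show "g n - kappa y (p_series (initial_ideal gt I)) \<in>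
        ideal_power (mps_ring UNIV) (Idl\<^bsub>mps_ring UNIV\<^esub> range (\<lambda>i. monomial (var_mon i) 1)) d"
        by (rule mem_ideal_power) (simp add: g[OF n(1)] coef_kappa_p_series[OF assms(3) n(2)])
    qed
  qed
  moreover have "g n \<in> polys UNIV" if "n \<ge> 1" for n
    unfolding g[OF that] by (rule kappa_polys[OF numerator_finite])
  ultimately show ?thesis using p_series_loc_finite by blast
qed

end
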